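(* Let $\lambda=\langle0^{m_0},1^{m_1},\dots,s^{m_s}\rangle$ be a partition with $n=\sum_{r=0}^s m_r$ parts and $m_0\ge1$, and let $x_1,\dots,x_n>0$. The stationary probability of $\eta\in\Omega_\lambda$ in the multispecies PushTASEP with content $\lambda$ and site parameters $x_1,\dots,x_n$ is given by $$\pi(\eta)=\sum_{\substack{\hat\eta\in\widehat\Omega_\lambda:\\ \Pi(\hat\eta)=\eta}}\hat\pi(\hat\eta)=\frac1{Z_\lambda}\sum_{\substack{\hat\eta\in\widehat\Omega_\lambda:\\ \Pi(\hat\eta)=\eta}}\mathrm{wt}(\hat\eta),$$ where $\hat\pi(\hat\eta)=\mathrm{wt}(\hat\eta)/Z_\lambda$ and $Z_\lambda=\sum_{\hat\eta'\in\widehat\Omega_\lambda}\mathrm{wt}(\hat\eta')$.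
   Context: **Content and configurations.** $\langle 0^{m_0},1^{m_1},\dots,s^{m_s}\rangle$ denotes the partition $\lambda$ of length $n$ with exactly $m_r$ parts equal to $r$; $M_r=m_r+\cdots+m_s$ for $1\le r\le s$. $\Omega_\lambda$ is the set of all distinct rearrangements $\eta=(\eta_1,\dots,\eta_n)$ of $\lambda$. **Multispecies PushTASEP.** The sites $1,2,\dots,n$ are arranged clockwise on a ring (site $n$ is followed by site $1$). $\eta_j=r\ge1$ means that site $j$ holds a particle of species $r$; $\eta_j=0$ means that site $j$ is vacant. The process is the continuous-time Markov chain on $\Omega_\lambda$ in which a bell rings at each site $j$ independently at rate $1/x_j$. If site $j$ is vacant when its bell rings, nothing changes. Otherwise let $i_1=\eta_j$; this particle moves to the first site $j_2$ clockwise from $j$ with $i_2:=\eta_{j_2}<i_1$. If $i_2=0$ the jump is complete; otherwise the displaced particle of species $i_2$ moves to the first site $j_3$ clockwise from $j_2$ with $\eta_{j_3}<i_2$, and so on until a vacancy is filled. All these moves occur instantaneously and site $j$ is left vacant. The chain is irreducible. **Multiline diagrams.** $\widehat\Omega_\lambda$ is the set of configurations on the array with rows $1,\dots,s$ (from bottom to top) and columns $1,\dots,n$ (from left to right, arranged cyclically), in which each site holds either one particle or a vacancy, and row $r$ contains exactly $M_r$ particles. With $v_i(\hat\eta)$ the number of particles in column $i$, $\mathrm{wt}(\hat\eta)=\prod_{i=1}^n x_i^{v_i(\hat\eta)}$. **The map $\Pi:\widehat\Omega_\lambda\to\Omega_\lambda$.** Label the particles of $\hat\eta$ row by row from the top.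 All particles in row $s$ get label $s$. Once rows $s,\dots,r+1$ are labelled, process the particles of row $r+1$ in decreasing order of label (ties broken arbitrarily, e.g. from left to right): for a row-$(r+1)$ particle in column $j$, look in columns $j,j+1,\dots$ (cyclically) for the first particle in row $r$ not yet matched; match it and give it the same label. When all row-$(r+1)$ particles are processed, every unmatched particle in row $r$ gets label $r$. Finally, vacancies in row $1$ get label $0$. $\Pi(\hat\eta)$ is the sequence of labels in row $1$, read from column $1$ to column $n$. *)

theory Defs
  imports Complex_Main "HOL-Library.FuncSet" "HOL-Library.Indicator_Function"
    "HOL-Combinatorics.Multiset_Permutations"
begin

text \<open>
  Sites (columns) are numbered \<open>0, \<dots>, n - 1\<close>, so that the clockwise neighbour of \<open>j\<close> is
  \<open>(j + 1) mod n\<close>; rows of multiline diagrams and species keep the numbers \<open>1, \<dots>, s\<close>.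
  The content is given by \<open>s\<close> and the multiplicities \<open>m 0, \<dots>, m s\<close>, some of which may be zero.
\<close>

definition configs :: "nat \<Rightarrow> (nat \<Rightarrow> nat) \<Rightarrow> nat list set" where
  "configs s m = permutations_of_multiset (\<Sum>r\<le>s. replicate_mset (m r) r)"


section \<open>The multispecies PushTASEP\<close>

definition next_lower :: "nat list \<Rightarrow> nat \<Rightarrow> nat \<Rightarrow> nat" where
  "next_lower \<eta> j i =
     (let n = length \<eta> in (j + (LEAST d. 1 \<le> d \<and> \<eta> ! ((j + d) mod n) < i)) mod n)"

text \<open>
  \<open>push \<eta> j i\<close> is the result of a particle of species \<open>i\<close> leaving site \<open>j\<close>, together with all the
  displacements this causes; site \<open>j\<close> itself is not yet emptied. The test \<open>i' < i\<close> always succeeds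
  if there is a vacancy and only serves to make the recursion terminate unconditionally.
\<close>

function push :: "nat list \<Rightarrow> nat \<Rightarrow> nat \<Rightarrow> nat list" where
  "push \<eta> j i =
     (let j' = next_lower \<eta> j i; i' = \<eta> ! j'
      in (if 0 < i' \<and> i' < i then push \<eta> j' i' else \<eta>)[j' := i])"
  by pat_completeness auto
termination
  by (relation "measure (\<lambda>(\<eta>, j, i). i)") auto

declare push.simps [simp del]

definition bell :: "nat \<Rightarrow> nat list \<Rightarrow> nat list" where
  "bell j \<eta> = (if \<eta> ! j = 0 then \<eta> else (push \<eta> j (\<eta> ! j))[j := 0])"

definition generator ::
    "nat \<Rightarrow> (nat \<Rightarrow> real) \<Rightarrow> (nat list \<Rightarrow> real) \<Rightarrow> nat list \<Rightarrow> real" where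
  "generator n x f \<eta> = (\<Sum>j<n. 1 / x j * (f (bell j \<eta>) - f \<eta>))"

text \<open>
  The entries of the semigroup \<open>exp (t L)\<close>, where \<open>L\<close> is the generator: the probability that the
  chain started from \<open>\<eta>\<close> is in state \<open>\<zeta>\<close> at time \<open>t\<close>.
\<close>

definition transition_prob ::
    "nat \<Rightarrow> (nat \<Rightarrow> real) \<Rightarrow> real \<Rightarrow> nat list \<Rightarrow> nat list \<Rightarrow> real" where
  "transition_prob n x t \<eta> \<zeta> =
     (\<Sum>k. t ^ k / fact k * ((generator n x ^^ k) (indicator {\<zeta>})) \<eta>)"

definition stationary_distribution ::
    "nat \<Rightarrow> nat \<Rightarrow> (nat \<Rightarrow> nat) \<Rightarrow> (nat \<Rightarrow> real) \<Rightarrow> (nat list \<Rightarrow> real) \<Rightarrow> bool" where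
  "stationary_distribution n s m x p \<longleftrightarrow>
     (\<forall>\<eta>\<in>configs s m. 0 \<le> p \<eta>) \<and> (\<Sum>\<eta>\<in>configs s m. p \<eta>) = 1 \<and>
     (\<forall>t\<ge>0. \<forall>\<zeta>\<in>configs s m.
        (\<Sum>\<eta>\<in>configs s m. p \<eta> * transition_prob n x t \<eta> \<zeta>) = p \<zeta>)"


section \<open>Multiline diagrams\<close>

text \<open>A diagram maps each row to the set of columns occupied in that row.\<close>

definition diagrams :: "nat \<Rightarrow> nat \<Rightarrow> (nat \<Rightarrow> nat) \<Rightarrow> (nat \<Rightarrow> nat set) set" where
  "diagrams n s m = (\<Pi>\<^sub>E r\<in>{1..s}. {C. C \<subseteq> {..<n} \<and> card C = (\<Sum>i=r..s. m i)})"

definition column_count :: "nat \<Rightarrow> (nat \<Rightarrow> nat set) \<Rightarrow> nat \<Rightarrow> nat" where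
  "column_count s \<xi> i = card {r \<in> {1..s}. i \<in> \<xi> r}"

definition wt :: "nat \<Rightarrow> nat \<Rightarrow> (nat \<Rightarrow> real) \<Rightarrow> (nat \<Rightarrow> nat set) \<Rightarrow> real" where
  "wt n s x \<xi> = (\<Prod>i<n. x i ^ column_count s \<xi> i)"

definition partition_fun :: "nat \<Rightarrow> nat \<Rightarrow> (nat \<Rightarrow> nat) \<Rightarrow> (nat \<Rightarrow> real) \<Rightarrow> real" where
  "partition_fun n s m x = (\<Sum>\<xi>\<in>diagrams n s m. wt n s x \<xi>)"

definition diagram_prob ::
    "nat \<Rightarrow> nat \<Rightarrow> (nat \<Rightarrow> nat) \<Rightarrow> (nat \<Rightarrow> real) \<Rightarrow> (nat \<Rightarrow> nat set) \<Rightarrow> real" where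
  "diagram_prob n s m x \<xi> = wt n s x \<xi> / partition_fun n s m x"


section \<open>The labelling of a multiline diagram\<close>

text \<open>
  The labels of a row are a function of the column, with value \<open>0\<close> at vacancies and, while the row
  is being matched, also at the particles that are not yet matched.
\<close>

definition processing_order :: "nat \<Rightarrow> nat \<Rightarrow> (nat \<Rightarrow> nat) \<Rightarrow> nat list" where
  "processing_order n s L = [j. a \<leftarrow> rev [1..<Suc s], j \<leftarrow> [0..<n], L j = a]"

text \<open>Match the particle in column \<open>j\<close> of the row above, labelled by \<open>L\<close>, to the row \<open>C\<close>.\<close>

definition match_particle ::
    "nat \<Rightarrow> nat set \<Rightarrow> (nat \<Rightarrow> nat) \<Rightarrow> nat \<Rightarrow> (nat \<Rightarrow> nat) \<Rightarrow> (nat \<Rightarrow> nat)" where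
  "match_particle n C L j K =
     K((j + (LEAST d. (j + d) mod n \<in> C \<and> K ((j + d) mod n) = 0)) mod n := L j)"

definition label_row ::
    "nat \<Rightarrow> nat \<Rightarrow> nat \<Rightarrow> nat set \<Rightarrow> (nat \<Rightarrow> nat) \<Rightarrow> (nat \<Rightarrow> nat)" where
  "label_row n s r C L =
     (let K = fold (match_particle n C L) (processing_order n s L) (\<lambda>_. 0)
      in (\<lambda>k. if k \<in> C \<and> K k = 0 then r else K k))"

text \<open>
  The rows are labelled in the order \<open>s, \<dots>, 1\<close>, starting from an empty row above row \<open>s\<close>, so that
  all particles of row \<open>s\<close> are unmatched and get the label \<open>s\<close>.
\<close>

definition bottom_labels :: "nat \<Rightarrow> nat \<Rightarrow> (nat \<Rightarrow> nat set) \<Rightarrow> nat list" where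
  "bottom_labels n s \<xi> =
     map (foldr (\<lambda>r. label_row n s r (\<xi> r)) [1..<Suc s] (\<lambda>_. 0)) [0..<n]"

end

theory Submission
  imports Defs
begin

text \<open>
  Ringing a bell moves a carry once around the ring: at every site the larger of the carry and the
  resident label stays and the smaller one travels on. Since maxima and minima commute with
  thresholds, the set of sites with label at least \<open>t\<close> evolves as a one-species PushTASEP. Likewise
  the sites of a row labelled at least \<open>t\<close> are the departures of a cyclic discrete-time queue whose
  arrivals are those of the row above and whose services are the particles of the row.

  The bell of a queue's departures can be traded for a bell of its services and a bell of its
  arrivals. Iterating over the rows lifts each bell to multiline diagrams: in every row at most one
  particle moves, and the column where it comes to rest rings in the row above. Since each row step
  can be undone, the lift is a bijection \<open>(\<xi>, j) \<mapsto> (\<xi>', l)\<close> of diagrams with a marked column, and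
  \<open>wt \<xi>' / x l = wt \<xi> / x j\<close> by telescoping over the rows; hence \<open>wt\<close> projects to an invariant weight.
  It is the only one up to scaling, because ringing all bells in the order \<open>0, \<dots>, n - 1\<close> brings every
  configuration to the same decreasing one.
\<close>

section \<open>Carries and queues on a ring\<close>

definition cw :: "nat \<Rightarrow> nat \<Rightarrow> nat" where
  "cw n k = Suc k mod n"

lemma cw_less [simp]: "k < n \<Longrightarrow> cw n k < n"
  by (simp add: cw_def)

text \<open>Walking clockwise from \<open>j\<close> reaches every site. The step that returns to
  \<open>j\<close> is exempt because \<open>j\<close> is the base case; the recursions in
  \<open>pushes\<close> and in \<open>first_from_arc\<close> break at the same place.\<close>

lemma ring_induct [consumes 2, case_names start step]:
  fixes n :: nat
  assumes "j < n" "k < n"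
    and "P j"
    and "\<And>k. k < n \<Longrightarrow> cw n k \<noteq> j \<Longrightarrow> P k \<Longrightarrow> P (cw n k)"
  shows "P k"
proof -
  have *: "P ((j + d) mod n)" for d
  proof (induction d)
    case 0
    then show ?case using assms(1,3) by simp
  next
    case (Suc d)
    have "(j + Suc d) mod n = cw n ((j + d) mod n)"
      by (simp add: cw_def mod_Suc_eq)
    moreover have "(j + d) mod n < n" using assms(1) by simp
    ultimately show ?case using assms(3,4) Suc by metis
  qed
  have "(j + (n - j + k)) mod n = k" using assms(1,2) by simp
  then show ?thesis using *[of "n - j + k"] by simp
qed

lemma bij_betw_cw: "bij_betw (\<lambda>k. cw n k) {..<n} {..<n}"
proof -
  have "inj_on (\<lambda>k. cw n k) {..<n}"
    by (intro inj_onI) (auto simp: cw_def mod_Suc split: if_splits)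
  moreover have "(\<lambda>k. cw n k) ` {..<n} \<subseteq> {..<n}" by auto
  ultimately show ?thesis
    by (simp add: bij_betw_def endo_inj_surj)
qed

lemma sum_cw: "(\<Sum>k<n. h (cw n k)) = (\<Sum>k<n. h k)"
  using sum.reindex_bij_betw[OF bij_betw_cw] .

lemma ring_all: "(\<forall>k<n. P k) \<longleftrightarrow> (\<forall>k<n. P (cw n k))"
proof -
  have "{..<n} = (\<lambda>k. cw n k) ` {..<n}"
    using bij_betw_imp_surj_on[OF bij_betw_cw] by simp
  then have "(\<forall>k\<in>{..<n}. P k) \<longleftrightarrow> (\<forall>k\<in>{..<n}. P (cw n k))"
    by (metis (mono_tags, lifting) ball_imageD imageE)
  then show ?thesis by (simp only: Ball_def lessThan_iff)
qed

lemma ring_allI: "(\<And>k. k < n \<Longrightarrow> P (cw n k)) \<Longrightarrow> k < n \<Longrightarrow> P k"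
  using ring_all[of n P] by blast

text \<open>The search starts at distance 0, so \<open>j\<close> itself is a candidate, unlike in
  \<open>next_lower\<close>.\<close>

definition first_from :: "nat \<Rightarrow> nat \<Rightarrow> (nat \<Rightarrow> bool) \<Rightarrow> nat" where
  "first_from n j P = (j + (LEAST d. P ((j + d) mod n))) mod n"

lemma first_from_less: "j < n \<Longrightarrow> first_from n j P < n"
  by (simp add: first_from_def)

text \<open>The function \<open>e\<close> is the indicator of the cyclic interval from \<open>j\<close> up to, and excluding, the site found.\<close>

lemma first_from_arc:
  assumes "j < n" "\<exists>k<n. P k"
  obtains e :: "nat \<Rightarrow> nat" where
    "P (first_from n j P)"
    "first_from n j P = j \<longleftrightarrow> P j"
    "e j = of_bool (\<not> P j)"
    "\<And>k. k < n \<Longrightarrow> cw n k = j \<Longrightarrow> e k = 0"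
    "\<And>k. k < n \<Longrightarrow> cw n k \<noteq> j \<Longrightarrow> e (cw n k) = of_bool (e k = 1 \<and> \<not> P (cw n k))"
    "\<And>k. k < n \<Longrightarrow> cw n k \<noteq> j \<Longrightarrow>
       cw n k = first_from n j P \<longleftrightarrow> e k = 1 \<and> P (cw n k)"
proof -
  define D where "D = (LEAST d. P ((j + d) mod n))"
  \<comment> \<open>\<open>(k + (n - j)) mod n\<close> is the clockwise distance from
    \<open>j\<close> to \<open>k\<close>.\<close>
  define e :: "nat \<Rightarrow> nat" where "e k = of_bool ((k + (n - j)) mod n < D)" for k
  have D: "P ((j + D) mod n) \<and> D < n"
  proof -
    obtain k where k: "k < n" "P k" using assms(2) by blast
    define d where "d = (k + (n - j)) mod n"
    have "(j + d) mod n = k"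
      using assms(1) k(1) by (simp add: d_def mod_simps)
    then have "P ((j + d) mod n)" using k by simp
    moreover have "d < n" using assms(1) by (simp add: d_def)
    ultimately show ?thesis unfolding D_def by (metis (mono_tags, lifting) LeastI Least_le le_less_trans)
  qed
  have below: "\<not> P ((j + d) mod n)" if "d < D" for d
    using that not_less_Least unfolding D_def by blast
  have off: "(j + (k + (n - j)) mod n) mod n = k" if "k < n" for k
    using assms(1) that by (simp add: mod_simps)
  have ff: "first_from n j P = (j + D) mod n" by (simp add: first_from_def D_def)
  have step: "(cw n k + (n - j)) mod n = Suc ((k + (n - j)) mod n)"
    if "k < n" "cw n k \<noteq> j" for k
  proof -
    have "(cw n k + (n - j)) mod n = Suc ((k + (n - j)) mod n) mod n"
      by (simp add: cw_def mod_simps)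
    \<comment> \<open>The distance wraps around only on stepping into \<open>j\<close>, which is
      excluded here.\<close>
    moreover have "Suc ((k + (n - j)) mod n) \<noteq> n"
    proof
      assume "Suc ((k + (n - j)) mod n) = n"
      then have "(j + Suc ((k + (n - j)) mod n)) mod n = j" using assms(1) by simp
      moreover have "(j + Suc ((k + (n - j)) mod n)) mod n = cw n k"
        using off[OF that(1)] unfolding cw_def by (metis add_Suc_right mod_Suc_eq)
      ultimately show False using that by simp
    qed
    ultimately show ?thesis
      using assms(1) by (metis Suc_lessI gr_implies_not0 mod_less mod_less_divisor neq0_conv)
  qed
  have ffj: "first_from n j P = k \<longleftrightarrow> (k + (n - j)) mod n = D" if "k < n" for k
  proof
    assume "first_from n j P = k"
    then have "k = (j + D) mod n" using ff by simp
    then have "(k + (n - j)) mod n = (j + D + (n - j)) mod n" by (simp add: mod_simps)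
    also have "\<dots> = D" using D assms(1) by simp
    finally show "(k + (n - j)) mod n = D" .
  next
    assume "(k + (n - j)) mod n = D"
    then show "first_from n j P = k" using off[OF that] ff by simp
  qed
  have jj: "(j + (n - j)) mod n = 0" using assms(1) by simp
  show thesis
  proof (rule that[of e])
    show "P (first_from n j P)" using D ff by simp
    have zero: "D = 0 \<longleftrightarrow> P j"
      using D below[of 0] assms(1) by (cases "D = 0") auto
    show "first_from n j P = j \<longleftrightarrow> P j" using ffj[OF assms(1)] jj zero by auto
    show "e j = of_bool (\<not> P j)" using zero jj by (simp add: e_def)
  next
    fix k assume k: "k < n" "cw n k = j"
    have "(k + (n - j)) mod n = n - 1"
    proof (cases "Suc k = n")
      case True
      then show ?thesis using k by (auto simp: cw_def)
    next
      case False
      then have "j = Suc k" using k by (simp add: cw_def)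
      then show ?thesis using k assms by simp
    qed
    \<comment> \<open>The predecessor of \<open>j\<close> has the largest distance
      \<open>n - 1\<close>, and \<open>D < n\<close>.\<close>
    moreover have "\<not> n - 1 < D" using D by linarith
    ultimately show "e k = 0" by (simp add: e_def)
  next
    fix k assume k: "k < n" "cw n k \<noteq> j"
    let ?d = "(k + (n - j)) mod n"
    have k': "cw n k < n" using k by simp
    have P': "P (cw n k) \<longleftrightarrow> P ((j + Suc ?d) mod n)"
      using off[OF k'] step[OF k] by simp
    have notP: "Suc ?d < D \<Longrightarrow> \<not> P (cw n k)" using below P' by blast
    have isP: "Suc ?d = D \<Longrightarrow> P (cw n k)" using D P' by simp
    have e': "e (cw n k) = of_bool (Suc ?d < D)" "e k = of_bool (?d < D)"
      unfolding e_def step[OF k] by auto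
    obtain d k' where dk: "d = ?d" "k' = cw n k" by blast
    note gen = notP[folded dk] isP[folded dk] e'[folded dk] ffj[OF k', unfolded step[OF k], folded dk]
    have "e k' = of_bool (e k = 1 \<and> \<not> P k')"
      using gen by (cases "Suc d = D") fastforce+
    then show "e (cw n k) = of_bool (e k = 1 \<and> \<not> P (cw n k))"
      unfolding dk .
    have "k' = first_from n j P \<longleftrightarrow> e k = 1 \<and> P k'"
      using gen by (cases "Suc d = D") fastforce+
    then show "cw n k = first_from n j P \<longleftrightarrow> e k = 1 \<and> P (cw n k)"
      unfolding dk .
  qed
qed

text \<open>
  \<open>f\<close> and \<open>g\<close> are the labels before and after the bell of site \<open>j\<close>, and \<open>e k\<close> is the label carried from
  site \<open>k\<close> to its clockwise neighbour, \<open>0\<close> if none is.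
\<close>

definition pushes :: "nat \<Rightarrow> nat \<Rightarrow> (nat \<Rightarrow> nat) \<Rightarrow> (nat \<Rightarrow> nat) \<Rightarrow> (nat \<Rightarrow> nat) \<Rightarrow> bool" where
  "pushes n j f e g \<longleftrightarrow>
     (\<forall>k<n. if cw n k = j then e k = 0 \<and> g j = 0 \<and> e j = f j
       else g (cw n k) = max (f (cw n k)) (e k) \<and>
            e (cw n k) = min (f (cw n k)) (e k))"

lemma pushesD:
  assumes "pushes n j f e g" "k < n"
  shows "cw n k = j \<Longrightarrow> e k = 0"
    and "cw n k = j \<Longrightarrow> g j = 0"
    and "cw n k = j \<Longrightarrow> e j = f j"
    and "cw n k \<noteq> j \<Longrightarrow> g (cw n k) = max (f (cw n k)) (e k)"
    and "cw n k \<noteq> j \<Longrightarrow> e (cw n k) = min (f (cw n k)) (e k)"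
proof -
  have "if cw n k = j then e k = 0 \<and> g j = 0 \<and> e j = f j
       else g (cw n k) = max (f (cw n k)) (e k) \<and>
            e (cw n k) = min (f (cw n k)) (e k)"
    using assms unfolding pushes_def by blast
  then show "cw n k = j \<Longrightarrow> e k = 0"
    and "cw n k = j \<Longrightarrow> g j = 0"
    and "cw n k = j \<Longrightarrow> e j = f j"
    and "cw n k \<noteq> j \<Longrightarrow> g (cw n k) = max (f (cw n k)) (e k)"
    and "cw n k \<noteq> j \<Longrightarrow> e (cw n k) = min (f (cw n k)) (e k)"
    by (simp_all only: if_True if_False)
qed

section \<open>Determinacy, thresholds and conservation for carries\<close>

lemma ring_pred:
  assumes "j < n"
  obtains k where "k < n" "cw n k = j"
proof -
  have "j \<in> (\<lambda>k. cw n k) ` {..<n}"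
    using assms bij_betw_imp_surj_on[OF bij_betw_cw] by simp
  then show thesis using that by (elim imageE) simp
qed

lemma pushes_start:
  assumes "pushes n j f e g" "j < n"
  shows "g j = 0" "e j = f j"
  using ring_pred[OF assms(2)] pushesD(2,3)[OF assms(1)] by metis+

lemma pushes_carry_unique:
  assumes "pushes n j f e g" "pushes n j f e' g'" "j < n" "k < n"
  shows "e k = e' k"
  using assms(3,4)
proof (induction rule: ring_induct)
  case start
  then show ?case using pushes_start assms by metis
next
  case (step k)
  then show ?case using pushesD(5)[OF assms(1)] pushesD(5)[OF assms(2)] by metis
qed

lemma pushes_unique:
  assumes "pushes n j f e g" "pushes n j f e' g'" "j < n" "k < n"
  shows "g k = g' k"
  using assms(4)
proof (rule ring_allI[rotated])
  fix k assume "k < n"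
  then show "g (cw n k) = g' (cw n k)"
    using pushesD[OF assms(1), of k] pushesD[OF assms(2), of k]
      pushes_carry_unique[OF assms(1,2,3), of k]
    by (cases "cw n k = j") auto
qed

text \<open>Thresholds commute with \<open>max\<close> and \<open>min\<close>. Positivity of
  \<open>t\<close> sends both a vacancy and an absent carry to 0.\<close>

lemma pushes_threshold:
  assumes "pushes n j f e g" "0 < t"
  shows "pushes n j (\<lambda>k. of_bool (t \<le> f k)) (\<lambda>k. of_bool (t \<le> e k)) (\<lambda>k. of_bool (t \<le> g k))"
  using assms unfolding pushes_def by (auto simp: max_def min_def)

text \<open>At each site \<open>max\<close> and \<open>min\<close> only redistribute the resident
  and the incoming carry. Summed over the ring, every carry appears once as outgoing and once as
  incoming, and cancels.\<close>

lemma pushes_mset: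
  assumes "pushes n j f e g"
  shows "image_mset g (mset_set {..<n}) = image_mset f (mset_set {..<n})"
proof -
  have *: "{#g (cw n k)#} + {#e (cw n k)#} = {#f (cw n k)#} + {#e k#}" if "k < n" for k
    using pushesD[OF assms that] by (cases "cw n k = j") (auto simp: max_def min_def)
  have "(\<Sum>k<n. {#g (cw n k)#}) + (\<Sum>k<n. {#e (cw n k)#}) =
      (\<Sum>k<n. {#f (cw n k)#}) + (\<Sum>k<n. {#e k#})"
    unfolding sum.distrib[symmetric] by (intro sum.cong) (use * in auto)
  then have "(\<Sum>k<n. {#g k#}) = (\<Sum>k<n. {#f k#})"
    unfolding sum_cw[of "\<lambda>k. {#g k#}"] sum_cw[of "\<lambda>k. {#f k#}"]
      sum_cw[of "\<lambda>k. {#e k#}"] by simp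
  then show ?thesis
    by (simp add: sum_unfold_sum_mset)
qed

text \<open>With \<open>c\<close> the carry entering \<open>k\<close>, the new labels are
  \<open>max (f k) c\<close> at \<open>k\<close> and \<open>max (f (Suc k)) (min (f k) c)\<close> at
  \<open>Suc k\<close>, and the latter cannot be larger. Site \<open>j\<close> is left with 0, so
  the decreasing stretch grows by one site.\<close>

lemma pushes_decreasing:
  assumes "pushes n j f e g" "j < n" "\<And>k. Suc k < j \<Longrightarrow> f (Suc k) \<le> f k" "k < j"
  shows "g (Suc k) \<le> g k"
proof (cases "Suc k = j")
  case True
  then show ?thesis using pushes_start[OF assms(1,2)] by simp
next
  case False
  with assms have k: "Suc k < j" "Suc k < n" by auto
  then obtain i where i: "i < n" "cw n i = k" using ring_pred[of k n] by auto
  have "g (Suc k) = max (f (Suc k)) (e k)" using pushesD(4)[OF assms(1), of k] k by (simp add: cw_def)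
  moreover have "g k = max (f k) (e i)" "e k = min (f k) (e i)"
    using pushesD(4,5)[OF assms(1) i(1)] i k by auto
  ultimately show ?thesis using assms(3)[OF k(1)] by auto
qed

text \<open>
  Arrivals \<open>a\<close>, services \<open>c\<close>, departures \<open>d\<close>; \<open>q k\<close> is the queue length after the service at site \<open>k\<close>.
  An arrival can be served at its own site.
\<close>

definition queue :: "nat \<Rightarrow> (nat \<Rightarrow> nat) \<Rightarrow> (nat \<Rightarrow> nat) \<Rightarrow> (nat \<Rightarrow> nat) \<Rightarrow> bool" where
  "queue n a c d \<longleftrightarrow>
     (\<exists>q::nat \<Rightarrow> nat. \<forall>k<n. let k' = cw n k in
        q k' + d k' = q k + a k' \<and> d k' \<le> c k' \<and> (d k' < c k' \<longrightarrow> q k' = 0))"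

section \<open>Conservation, uniqueness and insertion for cyclic queues\<close>

lemma queueI:
  assumes "\<And>k. k < n \<Longrightarrow> q (cw n k) + d (cw n k) = q k + a (cw n k)"
    and "\<And>k. k < n \<Longrightarrow> d k \<le> c k"
    and "\<And>k. k < n \<Longrightarrow> d k < c k \<Longrightarrow> q k = 0"
  shows "queue n a c d"
  unfolding queue_def Let_def using assms by (intro exI[of _ q]) auto

lemma queueE:
  assumes "queue n a c d"
  obtains q :: "nat \<Rightarrow> nat" where
    "\<And>k. k < n \<Longrightarrow> q (cw n k) + d (cw n k) = q k + a (cw n k)"
    "\<And>k. k < n \<Longrightarrow> d k \<le> c k"
    "\<And>k. k < n \<Longrightarrow> d k < c k \<Longrightarrow> q k = 0"
proof -
  from assms obtain q :: "nat \<Rightarrow> nat" where q: "\<forall>k<n. let k' = cw n k in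
        q k' + d k' = q k + a k' \<and> d k' \<le> c k' \<and> (d k' < c k' \<longrightarrow> q k' = 0)"
    unfolding queue_def by blast
  show thesis
  proof (rule that[of q])
    show "q (cw n k) + d (cw n k) = q k + a (cw n k)" if "k < n" for k
      using q that by (simp add: Let_def)
    have "\<forall>k<n. d k \<le> c k \<and> (d k < c k \<longrightarrow> q k = 0)"
      by (subst ring_all) (use q in \<open>simp add: Let_def\<close>)
    then show "k < n \<Longrightarrow> d k \<le> c k" "k < n \<Longrightarrow> d k < c k \<Longrightarrow> q k = 0" for k by auto
  qed
qed

lemma queue_le: "queue n a c d \<Longrightarrow> k < n \<Longrightarrow> d k \<le> c k"
  by (elim queueE)

lemma queue_cong:
  assumes "queue n a c d" "\<And>k. k < n \<Longrightarrow> a k = a' k" "\<And>k. k < n \<Longrightarrow> c k = c' k"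
    "\<And>k. k < n \<Longrightarrow> d k = d' k"
  shows "queue n a' c' d'"
proof -
  obtain q where q: "\<And>k. k < n \<Longrightarrow> q (cw n k) + d (cw n k) = q k + a (cw n k)"
    "\<And>k. k < n \<Longrightarrow> d k \<le> c k" "\<And>k. k < n \<Longrightarrow> d k < c k \<Longrightarrow> q k = 0"
    using queueE[OF assms(1)] by blast
  show ?thesis
  proof (rule queueI[of n q])
    fix k assume "k < n"
    then have "cw n k < n" by simp
    then show "q (cw n k) + d' (cw n k) = q k + a' (cw n k)"
      using q(1)[OF \<open>k < n\<close>] assms(2,4) by metis
  qed (use q assms in auto)
qed

text \<open>Summing the conservation law around the ring cancels the queue lengths.\<close>

lemma queue_sum:
  assumes "queue n a c d"
  shows "(\<Sum>k<n. d k) = (\<Sum>k<n. a k)"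
proof -
  obtain q where q: "\<And>k. k < n \<Longrightarrow> q (cw n k) + d (cw n k) = q k + a (cw n k)"
    using queueE[OF assms] by metis
  have "(\<Sum>k<n. q (cw n k)) + (\<Sum>k<n. d (cw n k)) = (\<Sum>k<n. q k) + (\<Sum>k<n. a (cw n k))"
    unfolding sum.distrib[symmetric] by (intro sum.cong) (use q in auto)
  then show ?thesis by (simp add: sum_cw)
qed

text \<open>A comparison of the queue lengths at one site spreads to the whole ring and orders the
  departures; equal totals then force equality. Only departures are compared: when every service is
  used, the queue lengths are determined only up to a constant.\<close>

lemma queue_unique_aux:
  fixes q q' :: "nat \<Rightarrow> nat"
  assumes q: "\<And>k. k < n \<Longrightarrow> q (cw n k) + d (cw n k) = q k + a (cw n k)"
    "\<And>k. k < n \<Longrightarrow> d k \<le> c k" "\<And>k. k < n \<Longrightarrow> d k < c k \<Longrightarrow> q k = 0"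
  assumes q': "\<And>k. k < n \<Longrightarrow> q' (cw n k) + d' (cw n k) = q' k + a (cw n k)"
    "\<And>k. k < n \<Longrightarrow> d' k \<le> c k" "\<And>k. k < n \<Longrightarrow> d' k < c k \<Longrightarrow> q' k = 0"
  assumes j: "j < n" "q j \<le> q' j" and k: "k < n"
  shows "d k = d' k"
proof -
  \<comment> \<open>If the first queue leaves a service idle it is empty; otherwise it serves at
    least as many as the second, so the order persists.\<close>
  have le: "q k \<le> q' k" if "k < n" for k
    using j(1) that
  proof (induction rule: ring_induct)
    case start
    then show ?case using j by simp
  next
    case (step k)
    have "cw n k < n" using step by simp
    then show ?case using step q(1)[of k] q'(1)[of k] q(2,3)[of "cw n k"] q'(2,3)[of "cw n k"]
      by (cases "d (cw n k) < c (cw n k)") linarith+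
  qed
  \<comment> \<open>If the second queue leaves a service idle, both are empty after it, so each has
    served all it held, and the first held no more.\<close>
  have dd: "d k \<le> d' k" if "k < n" for k
  proof (cases "d' k < c k")
    case True
    then have 0: "q' k = 0" "q k = 0" using q'(3)[OF that] le[OF that] by auto
    obtain i where i: "i < n" "cw n i = k" using ring_pred \<open>k < n\<close> by blast
    show ?thesis using q(1)[OF i(1)] q'(1)[OF i(1)] i(2) 0 le[OF i(1)] by simp
  next
    case False
    then show ?thesis using q(2)[OF that] q'(2)[OF that] by simp
  qed
  have "(\<Sum>k<n. d k) = (\<Sum>k<n. d' k)"
    using queue_sum[OF queueI[of n q d a c]] queue_sum[OF queueI[of n q' d' a c]] q q' by metis
  then show ?thesis
    using dd k sum_mono_inv[of d "{..<n}" d' k] by auto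
qed

lemma queue_unique:
  assumes "queue n a c d" "queue n a c d'" "k < n"
  shows "d k = d' k"
proof -
  obtain q where q: "\<And>k. k < n \<Longrightarrow> q (cw n k) + d (cw n k) = q k + a (cw n k)"
    "\<And>k. k < n \<Longrightarrow> d k \<le> c k" "\<And>k. k < n \<Longrightarrow> d k < c k \<Longrightarrow> q k = 0"
    using queueE[OF assms(1)] by blast
  obtain q' where q': "\<And>k. k < n \<Longrightarrow> q' (cw n k) + d' (cw n k) = q' k + a (cw n k)"
    "\<And>k. k < n \<Longrightarrow> d' k \<le> c k" "\<And>k. k < n \<Longrightarrow> d' k < c k \<Longrightarrow> q' k = 0"
    using queueE[OF assms(2)] by blast
  show ?thesis
  proof (cases "q k \<le> q' k")
    case True
    then show ?thesis using queue_unique_aux[OF q q' assms(3) True assms(3)] by blast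
  next
    case False
    then have le: "q' k \<le> q k" by simp
    show ?thesis using queue_unique_aux[OF q' q assms(3) le assms(3)] by simp
  qed
qed

text \<open>The extra customer waits from \<open>j\<close> until the first idle service. The queue
  grows by one exactly on the arc in between, and the other departures are untouched.\<close>

lemma queue_add:
  assumes "queue n a c d" "j < n" "\<exists>k<n. d k < c k"
  defines "l \<equiv> first_from n j (\<lambda>k. d k < c k)"
  shows "queue n (a(j := Suc (a j))) c (d(l := Suc (d l)))"
proof -
  obtain q where q: "\<And>k. k < n \<Longrightarrow> q (cw n k) + d (cw n k) = q k + a (cw n k)"
    "\<And>k. k < n \<Longrightarrow> d k \<le> c k" "\<And>k. k < n \<Longrightarrow> d k < c k \<Longrightarrow> q k = 0"
    using queueE[OF assms(1)] by blast
  obtain e where e: "d l < c l" "l = j \<longleftrightarrow> d j < c j" "e j = of_bool (\<not> d j < c j)"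
    "\<And>k. k < n \<Longrightarrow> cw n k = j \<Longrightarrow> e k = (0::nat)"
    "\<And>k. k < n \<Longrightarrow> cw n k \<noteq> j \<Longrightarrow> e (cw n k) = of_bool (e k = 1 \<and> \<not> d (cw n k) < c (cw n k))"
    "\<And>k. k < n \<Longrightarrow> cw n k \<noteq> j \<Longrightarrow>
       cw n k = l \<longleftrightarrow> e k = 1 \<and> d (cw n k) < c (cw n k)"
    unfolding l_def by (rule first_from_arc[OF assms(2,3)]) blast
  \<comment> \<open>The arc contains no idle service, so lengthening the queue on it keeps the queue
    empty wherever a service stays idle.\<close>
  have e0: "e k = 0" if "k < n" "d k < c k" for k
    using that(1) that(2)
  proof (rule ring_allI[where P = "\<lambda>k. d k < c k \<longrightarrow> e k = 0", rule_format, rotated])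
    fix k assume "k < n" "d (cw n k) < c (cw n k)"
    then show "e (cw n k) = 0" using e(3) e(5)[of k] by (cases "cw n k = j") auto
  qed
  have e1: "e k = 0 \<or> e k = 1" if "k < n" for k
    using that
  proof (rule ring_allI[rotated])
    fix k assume "k < n"
    then show "e (cw n k) = 0 \<or> e (cw n k) = 1" using e(3) e(5)[of k]
      by (cases "cw n k = j") auto
  qed
  show ?thesis
  proof (rule queueI[of n "\<lambda>k. q k + e k"])
    fix k assume k: "k < n"
    show "q (cw n k) + e (cw n k) + (d(l := Suc (d l))) (cw n k) =
        q k + e k + (a(j := Suc (a j))) (cw n k)"
      using q(1)[OF k] e(2,3) e(4-6)[OF k] e1[OF k]
      by (cases "cw n k = j"; cases "cw n k = l") auto
    show "(d(l := Suc (d l))) k \<le> c k" using q(2)[OF k] e(1) by auto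
    show "(d(l := Suc (d l))) k < c k \<Longrightarrow> q k + e k = 0"
      using q(3)[OF k] e0[OF k] by (auto split: if_splits)
  qed
qed

text \<open>
  The interchange law behind the theorem: ringing the bell of site \<open>j\<close> for the departures is the
  same as ringing it for the services and then ringing, for the arrivals, the bell of the site \<open>l\<close>
  at which the service moved from \<open>j\<close> comes to rest. The new queue length is \<open>q + eD - eA\<close>.
\<close>

lemma queue_pushes:
  assumes "queue n a c d" "j < n" "l < n"
    and c01: "\<And>k. k < n \<Longrightarrow> c k \<le> 1" and a01: "\<And>k. k < n \<Longrightarrow> a k \<le> 1"
    and pD: "pushes n j d eD d'" and pC: "pushes n j c eC c'" and pA: "pushes n l a eA a'"
    and l: "l = j \<longleftrightarrow> c j = 0"
      "\<And>k. k < n \<Longrightarrow> cw n k \<noteq> j \<Longrightarrow> cw n k = l \<longleftrightarrow> eC k = 1 \<and> c (cw n k) = 0"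
  shows "queue n a' c' d'"
proof -
  obtain q where q: "\<And>k. k < n \<Longrightarrow> q (cw n k) + d (cw n k) = q k + a (cw n k)"
    "\<And>k. k < n \<Longrightarrow> d k \<le> c k" "\<And>k. k < n \<Longrightarrow> d k < c k \<Longrightarrow> q k = 0"
    using queueE[OF assms(1)] by blast
  \<comment> \<open>The service carry never falls behind the departure carry. Where it is strictly
    ahead, the queue is empty.\<close>
  have I: "eD k \<le> eC k \<and> eC k \<le> 1 \<and> (eD k < eC k \<longrightarrow> q k = 0) \<and> eC k \<le> c k" if "k < n" for k
    using \<open>j < n\<close> that
  proof (induction rule: ring_induct)
    case start
    show ?case using q(2,3)[OF \<open>j < n\<close>] c01[OF \<open>j < n\<close>] pushes_start[OF pD \<open>j < n\<close>] pushes_start[OF pC \<open>j < n\<close>]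
      by simp
  next
    case (step k)
    let ?k = "cw n k"
    have k': "?k < n" using step by simp
    have s: "eD ?k = min (d ?k) (eD k)" "eC ?k = min (c ?k) (eC k)"
      using pushesD(5)[OF pD] pushesD(5)[OF pC] step by auto
    have "q ?k = 0" if "eD ?k < eC ?k"
    proof -
      have "eC k = 1" "c ?k = 1" using that s step c01[OF k'] by auto
      show ?thesis
      proof (cases "d ?k < c ?k")
        case True
        then show ?thesis using q(3) k' by blast
      next
        case False
        then have "eD k < eC k" using that s by auto
        then have "q k = 0" using step by simp
        then show ?thesis using q(1)[OF step(1)] False q(2)[OF k'] \<open>c ?k = 1\<close> a01[OF k'] by simp
      qed
    qed
    then show ?case using s step q(2)[OF k'] c01[OF k'] by auto
  qed
  \<comment> \<open>There is no service at \<open>l\<close>, so an arrival there has to wait: the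
    arrival carry is always one of the customers in the queue.\<close>
  have A: "eA k \<le> 1 \<and> eA k \<le> q k" if "k < n" for k
    using \<open>l < n\<close> that
  proof (induction rule: ring_induct)
    case start
    obtain i where i: "i < n" "cw n i = l" using ring_pred \<open>l < n\<close> by blast
    have cl: "c l = 0" using l(1) l(2)[OF i(1)] i(2) by metis
    then have "d l = 0" using q(2)[OF \<open>l < n\<close>] by simp
    then have "a l \<le> q l" using q(1)[OF i(1)] i(2) by simp
    then show ?case using pushes_start[OF pA \<open>l < n\<close>] a01[OF \<open>l < n\<close>] by simp
  next
    case (step k)
    let ?k = "cw n k"
    have k': "?k < n" using step by simp
    have "eA ?k = min (a ?k) (eA k)" using pushesD(5)[OF pA] step by auto
    then show ?case using q(1)[OF step(1)] q(2)[OF k'] c01[OF k'] step(3) a01[OF k'] by auto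
  qed
  \<comment> \<open>Since \<open>eA k \<le> q k\<close>, the natural-number subtraction below is a
    true one.\<close>
  have main: "q k' + eD k' - eA k' + d' k' = q k + eD k - eA k + a' k' \<and> d' k' \<le> c' k' \<and>
    (d' k' < c' k' \<longrightarrow> q k' + eD k' - eA k' = 0)"
    if k: "k < n" and k'_def: "k' = cw n k" for k k'
  proof -
    have kn: "k' < n" using k k'_def by simp
    note facts = q(1)[OF k, folded k'_def] q(2,3)[OF kn] I[OF k] I[OF kn] A[OF k] A[OF kn] c01[OF kn] a01[OF kn]
    show ?thesis
    proof (cases "k' = j")
      case True
      note D = pushesD(1,2,3)[OF pD k, folded k'_def, OF True]
      note C = pushesD(1,2,3)[OF pC k, folded k'_def, OF True]
      show ?thesis
      proof (cases "k' = l")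
        case True': True
        show ?thesis using facts D C pushesD(1,2,3)[OF pA k, folded k'_def, OF True'] True True' l(1) by simp
      next
        case False
        then have "a' j = max (a j) (eA k)" "eA j = min (a j) (eA k)" 
          using pushesD(4,5)[OF pA k, folded k'_def] True by auto
        then show ?thesis using facts D C True by (auto simp: max_def min_def)
      qed
    next
      case False
      note D = pushesD(4,5)[OF pD k, folded k'_def, OF False]
      note C = pushesD(4,5)[OF pC k, folded k'_def, OF False]
      note L = l(2)[OF k, folded k'_def, OF False]
      show ?thesis
      proof (cases "k' = l")
        case True
        note pushesD(1,2,3)[OF pA k, folded k'_def, OF True]
        then show ?thesis using facts D C L True by (auto simp: max_def min_def)
      next
        case False
        note pushesD(4,5)[OF pA k, folded k'_def, OF False]
        then show ?thesis using facts D C L False by (auto simp: max_def min_def split: if_splits)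
      qed
    qed
  qed
  have main2: "\<forall>k<n. d' k \<le> c' k \<and> (d' k < c' k \<longrightarrow> q k + eD k - eA k = 0)"
    by (subst ring_all) (use main in auto)
  show ?thesis
    by (rule queueI[of n "\<lambda>k. q k + eD k - eA k"]) (use main main2 in auto)
qed

section \<open>The labelling of a row\<close>

lemma first_from_sat: "j < n \<Longrightarrow> \<exists>k<n. P k \<Longrightarrow> P (first_from n j P)"
  by (erule first_from_arc)

lemma processing_order_0 [simp]: "processing_order n 0 L = []"
  by (simp add: processing_order_def)

lemma processing_order_Suc:
  "processing_order n (Suc s) L = filter (\<lambda>j. L j = Suc s) [0..<n] @ processing_order n s L"
proof -
  have "concat (map (\<lambda>j. if P j then [j] else []) xs) = filter P xs" for P and xs :: "nat list"
    by (induction xs) auto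
  then show ?thesis by (simp add: processing_order_def)
qed

lemma set_processing_order: "set (processing_order n s L) = {j. j < n \<and> 0 < L j \<and> L j \<le> s}"
proof (induction s)
  case (Suc s)
  then show ?case
    unfolding processing_order_Suc set_append set_filter set_upt Suc.IH
    by (auto simp: le_Suc_eq)
qed auto

lemma distinct_processing_order: "distinct (processing_order n s L)"
proof (induction s)
  case (Suc s)
  then show ?case
    unfolding processing_order_Suc distinct_append set_processing_order by auto
qed simp

lemma sorted_processing_order: "sorted_wrt (\<lambda>i j. L j \<le> L i) (processing_order n s L)"
proof (induction s)
  case (Suc s)
  have "sorted_wrt (\<lambda>i j. L j \<le> L i) (filter (\<lambda>j. L j = Suc s) xs)" for xs
    by (induction xs) auto
  with Suc show ?case
    by (auto simp: processing_order_Suc set_processing_order sorted_wrt_append)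
qed simp

lemma sum_of_bool_lessThan:
  fixes n :: nat
  shows "(\<Sum>k<n. of_bool (P k) :: nat) = card {k. k < n \<and> P k}"
proof -
  have "{k. k < n \<and> P k} = {..<n} \<inter> {k. P k}" by auto
  then show ?thesis by (simp only: sum_of_bool_eq finite_lessThan of_nat_id)
qed

text \<open>Each matched particle is an extra arrival for the thresholds up to its label, handled by
  \<open>queue_add\<close>, and invisible to higher ones. Processing in decreasing order makes the
  vacant places the same for all thresholds concerned.\<close>

lemma fold_match_particle:
  fixes L :: "nat \<Rightarrow> nat"
  assumes C: "C \<subseteq> {..<n}"
    and "\<forall>j\<in>set js. j < n \<and> 0 < L j" "distinct js" "sorted_wrt (\<lambda>i j. L j \<le> L i) js"
      "length js \<le> card C"
  defines "K \<equiv> \<lambda>js. fold (match_particle n C L) js (\<lambda>_. 0)"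
  shows "(\<forall>k. K js k \<noteq> 0 \<longrightarrow> K js k \<in> L ` set js) \<and>
    (\<forall>t>0. queue n (\<lambda>k. of_bool (k \<in> set js \<and> t \<le> L k)) (\<lambda>k. of_bool (k \<in> C))
       (\<lambda>k. of_bool (t \<le> K js k)))"
  using assms(2-5)
proof (induction js rule: rev_induct)
  case Nil
  have "queue n (\<lambda>k. 0) c (\<lambda>k. 0)" for c
    by (rule queueI[of n "\<lambda>_. 0"]) auto
  then show ?case by (simp add: K_def)
next
  case (snoc j js)
  have IH: "\<And>k. K js k \<noteq> 0 \<Longrightarrow> K js k \<in> L ` set js"
    "\<And>t. t > 0 \<Longrightarrow> queue n (\<lambda>k. of_bool (k \<in> set js \<and> t \<le> L k)) (\<lambda>k. of_bool (k \<in> C))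
       (\<lambda>k. of_bool (t \<le> K js k))"
    using snoc by (auto simp: sorted_wrt_append)
  have j: "j < n" "0 < L j" "j \<notin> set js" "\<And>i. i \<in> set js \<Longrightarrow> L j \<le> L i"
    using snoc.prems by (auto simp: sorted_wrt_append)
  define l where "l = first_from n j (\<lambda>k. k \<in> C \<and> K js k = 0)"
  have K': "K (js @ [j]) = (K js)(l := L j)"
    by (simp add: K_def match_particle_def l_def first_from_def)
  have KC: "K js k \<noteq> 0 \<Longrightarrow> k < n \<Longrightarrow> k \<in> C" for k
    using queue_le[OF IH(2)[of 1], of k] by (auto simp: of_bool_def split: if_splits)
  \<comment> \<open>By conservation at threshold 1, the particles matched so far number
    \<open>length js\<close>, which is less than \<open>card C\<close>.\<close>
  have free: "\<exists>k<n. k \<in> C \<and> K js k = 0"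
  proof (rule ccontr)
    assume *: "\<not> ?thesis"
    have "card C = card {k. k < n \<and> 1 \<le> K js k}"
      using * C KC by (intro arg_cong[of _ _ card]) force
    also have "\<dots> = (\<Sum>k<n. of_bool (1 \<le> K js k))"
      by (simp add: sum_of_bool_lessThan)
    also have "\<dots> = (\<Sum>k<n. of_bool (k \<in> set js \<and> 1 \<le> L k))"
      using queue_sum[OF IH(2)[of 1]] by simp
    also have "\<dots> = card {k. k < n \<and> k \<in> set js \<and> 1 \<le> L k}"
      by (simp only: sum_of_bool_lessThan)
    also have "\<dots> = card (set js)"
      using snoc.prems(1) by (intro arg_cong[of _ _ card]) force
    also have "\<dots> < card C"
      using snoc.prems(4) card_length[of js] by simp
    finally show False by simp
  qed
  then have l: "l \<in> C" "K js l = 0"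
    unfolding l_def using first_from_sat[OF j(1) free] by auto
  show ?case
  proof (intro conjI allI impI)
    show "K (js @ [j]) k \<in> L ` set (js @ [j])" if "K (js @ [j]) k \<noteq> 0" for k
      using that IH(1)[of k] by (auto simp: K' split: if_splits)
  next
    fix t :: nat assume t: "0 < t"
    show "queue n (\<lambda>k. of_bool (k \<in> set (js @ [j]) \<and> t \<le> L k)) (\<lambda>k. of_bool (k \<in> C))
       (\<lambda>k. of_bool (t \<le> K (js @ [j]) k))"
    proof (cases "t \<le> L j")
      case False
      show ?thesis
        by (rule queue_cong[OF IH(2)[OF t]]) (use False l t in \<open>auto simp: K'\<close>)
    next
      case True
      \<comment> \<open>All labels placed so far are at least \<open>L j\<close>, hence at least
        \<open>t\<close>: being matched and passing the threshold coincide.\<close>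
      have eq: "t \<le> K js k \<longleftrightarrow> K js k \<noteq> 0" for k
        using IH(1)[of k] j(4) True t by (cases "K js k = 0") (force dest: order_trans)+
      have lt: "(of_bool (t \<le> K js k) :: nat) < of_bool (k \<in> C) \<longleftrightarrow> k \<in> C \<and> K js k = 0" for k
        by (auto simp: eq)
      show ?thesis
        by (rule queue_cong[OF queue_add[OF IH(2)[OF t] j(1), unfolded lt, OF free, folded l_def]])
          (use True j l t in \<open>auto simp: K' eq\<close>)
    qed
  qed
qed

text \<open>Unmatched particles get \<open>r\<close>, which thresholds above \<open>r\<close> do not
  see, so the queue of matched labels survives there. Matched labels exceed \<open>r\<close>, so
  thresholds up to \<open>r\<close> see every particle of the row.\<close>

lemma label_row:
  assumes C: "C \<subseteq> {..<n}"
    and L: "\<forall>k<n. L k \<le> s \<and> (L k \<noteq> 0 \<longrightarrow> r < L k)"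
    and card: "card {k. k < n \<and> 0 < L k} \<le> card C"
  defines "D \<equiv> label_row n s r C L"
  shows "0 < t \<Longrightarrow> r < t \<Longrightarrow> queue n (\<lambda>k. of_bool (t \<le> L k)) (\<lambda>k. of_bool (k \<in> C)) (\<lambda>k. of_bool (t \<le> D k))"
    and "0 < t \<Longrightarrow> t \<le> r \<Longrightarrow> k < n \<Longrightarrow> t \<le> D k \<longleftrightarrow> k \<in> C"
    and "k < n \<Longrightarrow> D k \<noteq> 0 \<Longrightarrow> r \<le> D k"
    and "k < n \<Longrightarrow> r \<le> s \<Longrightarrow> D k \<le> s"
proof -
  define js where "js = processing_order n s L"
  define K where "K = fold (match_particle n C L) js (\<lambda>_. 0)"
  have D: "D k = (if k \<in> C \<and> K k = 0 then r else K k)" for k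
    by (simp add: D_def label_row_def K_def js_def Let_def)
  have set: "set js = {k. k < n \<and> 0 < L k}"
    using L by (auto simp: js_def set_processing_order)
  have K: "\<And>k. K k \<noteq> 0 \<Longrightarrow> K k \<in> L ` set js"
    "\<And>t. t > 0 \<Longrightarrow> queue n (\<lambda>k. of_bool (k \<in> set js \<and> t \<le> L k)) (\<lambda>k. of_bool (k \<in> C))
       (\<lambda>k. of_bool (t \<le> K k))"
    using fold_match_particle[OF C, of js L] set card sorted_processing_order[of L n s]
      distinct_processing_order[of n s L] distinct_card[of js]
    unfolding K_def[symmetric] by (auto simp: js_def[symmetric])
  have KC: "K k \<noteq> 0 \<Longrightarrow> k < n \<Longrightarrow> k \<in> C" for k
    using queue_le[OF K(2)[of 1], of k] by (auto simp: of_bool_def split: if_splits)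
  have KL: "r < K k \<and> K k \<le> s" if "K k \<noteq> 0" for k
    using K(1)[OF that] L set by auto
  show "queue n (\<lambda>k. of_bool (t \<le> L k)) (\<lambda>k. of_bool (k \<in> C)) (\<lambda>k. of_bool (t \<le> D k))" if "0 < t" "r < t"
    by (rule queue_cong[OF K(2)[OF that(1)]]) (use that in \<open>auto simp: set D\<close>)
  show "k < n \<Longrightarrow> D k \<noteq> 0 \<Longrightarrow> r \<le> D k" for k
    using KL[of k] by (auto simp: D)
  show "k < n \<Longrightarrow> r \<le> s \<Longrightarrow> D k \<le> s" for k
    using KL[of k] by (cases "K k = 0") (auto simp: D)
  show "t \<le> D k \<longleftrightarrow> k \<in> C" if "0 < t" "t \<le> r" "k < n"
    using KL[of k] KC[of k] that by (cases "K k = 0") (auto simp: D)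
qed

section \<open>The bells of configurations and rows\<close>

text \<open>Starting at distance 0 instead of 1 is harmless, as site \<open>j\<close> does not hold
  a species below \<open>i\<close>.\<close>

lemma next_lower_eq_first_from:
  assumes "i \<le> \<eta> ! j" "j < length \<eta>"
  shows "next_lower \<eta> j i = first_from (length \<eta>) j (\<lambda>k. \<eta> ! k < i)"
proof -
  have "(1 \<le> d \<and> \<eta> ! ((j + d) mod length \<eta>) < i) = (\<eta> ! ((j + d) mod length \<eta>) < i)" for d
    using assms by (cases "d = 0") auto
  then show ?thesis by (simp add: next_lower_def first_from_def Let_def)
qed

text \<open>Induction on the departing species: the first leg carries \<open>i\<close> from
  \<open>j\<close> to \<open>l\<close>, and the cascade from \<open>l\<close> is covered by the
  induction hypothesis. The two carries live on disjoint arcs and are glued. The result is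
  \<open>pushes\<close> without the emptying of \<open>j\<close>, which \<open>bell\<close>
  adds.\<close>

lemma push_carry:
  assumes "length \<eta> = n" "j < n" "\<exists>k<n. \<eta> ! k = 0" "0 < \<eta> ! j"
  shows "length (push \<eta> j (\<eta> ! j)) = n \<and>
    (\<exists>e. e j = \<eta> ! j \<and> (\<forall>k<n. if cw n k = j then e k = 0
       else push \<eta> j (\<eta> ! j) ! cw n k = max (\<eta> ! cw n k) (e k) \<and>
         e (cw n k) = min (\<eta> ! cw n k) (e k)))"
  using assms(2,4)
proof (induction "\<eta> ! j" arbitrary: j rule: less_induct)
  case less
  define i where "i = \<eta> ! j"
  define l where "l = first_from n j (\<lambda>k. \<eta> ! k < i)"
  define i' where "i' = \<eta> ! l"
  define \<zeta> where "\<zeta> = (if 0 < i' then push \<eta> l i' else \<eta>)"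
  have i: "0 < i" "j < n" using less.prems by (auto simp: i_def)
  have ex: "\<exists>k<n. \<eta> ! k < i" using assms(3) i by force
  obtain a :: "nat \<Rightarrow> nat" where a: "\<eta> ! l < i" "l = j \<longleftrightarrow> \<eta> ! j < i" "a j = of_bool (\<not> \<eta> ! j < i)"
    "\<And>k. k < n \<Longrightarrow> cw n k = j \<Longrightarrow> a k = 0"
    "\<And>k. k < n \<Longrightarrow> cw n k \<noteq> j \<Longrightarrow> a (cw n k) = of_bool (a k = 1 \<and> \<not> \<eta> ! cw n k < i)"
    "\<And>k. k < n \<Longrightarrow> cw n k \<noteq> j \<Longrightarrow> cw n k = l \<longleftrightarrow> a k = 1 \<and> \<eta> ! cw n k < i"
    unfolding l_def by (rule first_from_arc[OF i(2) ex]) blast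
  have l: "l < n" "l \<noteq> j" unfolding l_def using first_from_less i a(2) by (auto simp: i_def l_def)
  have push: "push \<eta> j i = \<zeta>[l := i]"
    using next_lower_eq_first_from[of i \<eta> j] i assms(1) a(1)
    by (subst push.simps) (simp add: Let_def \<zeta>_def i'_def l_def i_def)
  obtain e where e: "e l = i'" "length \<zeta> = n" "\<And>k. k < n \<Longrightarrow> cw n k = l \<Longrightarrow> e k = 0"
    "\<And>k. k < n \<Longrightarrow> cw n k \<noteq> l \<Longrightarrow> \<zeta> ! cw n k = max (\<eta> ! cw n k) (e k)"
    "\<And>k. k < n \<Longrightarrow> cw n k \<noteq> l \<Longrightarrow> e (cw n k) = min (\<eta> ! cw n k) (e k)"
  proof (cases "0 < i'")
    case True
    then have "length (push \<eta> l i') = n \<and>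
      (\<exists>e. e l = i' \<and> (\<forall>k<n. if cw n k = l then e k = 0
       else push \<eta> l i' ! cw n k = max (\<eta> ! cw n k) (e k) \<and> e (cw n k) = min (\<eta> ! cw n k) (e k)))"
      using less.hyps[OF a(1)[unfolded i_def] l(1)] unfolding i'_def by blast
    then obtain e where e: "length (push \<eta> l i') = n" "e l = i'"
      "\<forall>k<n. if cw n k = l then e k = 0
       else push \<eta> l i' ! cw n k = max (\<eta> ! cw n k) (e k) \<and> e (cw n k) = min (\<eta> ! cw n k) (e k)"
      by blast
    have \<zeta>: "\<zeta> = push \<eta> l i'" using True by (simp add: \<zeta>_def)
    show thesis
    proof (rule that[of e])
      fix k assume "k < n"
      then have *: "if cw n k = l then e k = 0
        else \<zeta> ! cw n k = max (\<eta> ! cw n k) (e k) \<and> e (cw n k) = min (\<eta> ! cw n k) (e k)"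
        using e(3) \<zeta> by blast
      show "cw n k = l \<Longrightarrow> e k = 0" using * by simp
      show "cw n k \<noteq> l \<Longrightarrow> \<zeta> ! cw n k = max (\<eta> ! cw n k) (e k)" using * by simp
      show "cw n k \<noteq> l \<Longrightarrow> e (cw n k) = min (\<eta> ! cw n k) (e k)" using * by simp
    qed (use e(1,2) \<zeta> in simp_all)
  next
    case False
    then show thesis using that[of "\<lambda>_. 0"] assms by (simp add: \<zeta>_def)
  qed
  have a01: "a k = 0 \<or> a k = 1" if "k < n" for k
    using i(2) that by (induction rule: ring_induct) (use a in auto)
  have zero: "e p = 0" if p: "p < n" "cw n p = j" for p
    \<comment> \<open>otherwise the carry would survive the sites from \<open>j\<close> to \<open>l\<close>, which hold species \<open>\<ge> i\<close>, and return to \<open>l\<close>\<close>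
  proof (rule ccontr)
    assume "e p \<noteq> 0"
    have ne: "a k = 1 \<longrightarrow> e k \<noteq> 0" if "k < n" for k
      using i(2) that
    proof (induction rule: ring_induct)
      case start
      then show ?case using e(5)[OF p(1)] \<open>e p \<noteq> 0\<close> p l i by (simp add: i_def)
    next
      case (step k)
      then show ?case using e(5)[of k] a(5,6)[of k] i by auto
    qed
    obtain k where k: "k < n" "cw n k = l" using ring_pred l by blast
    then show False using e(3)[OF k] a(6)[OF k(1)] ne[OF k(1)] l by simp
  qed
  \<comment> \<open>The cascade enters \<open>j\<close> with carry 0, and a \<open>min\<close> with
    0 keeps it 0 along the first leg.\<close>
  have inv: "a k = 1 \<longrightarrow> e k = 0" if "k < n" for k
    using i(2) that
  proof (induction rule: ring_induct)
    case start
    obtain p where "p < n" "cw n p = j" using ring_pred i by blast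
    then show ?case using zero[of p] e(5)[of p] l by simp
  next
    case (step k)
    then show ?case using a(1,5,6) e(5) by (auto simp: i'_def)
  qed
  define e' where "e' k = (if a k = 1 then i else e k)" for k
  have "if cw n k = j then e' k = 0
       else \<zeta>[l := i] ! cw n k = max (\<eta> ! cw n k) (e' k) \<and> e' (cw n k) = min (\<eta> ! cw n k) (e' k)"
    if k: "k < n" for k
  proof (cases "cw n k = j")
    case True
    then show ?thesis using a(4) zero k by (simp add: e'_def)
  next
    case False
    note a = a(5,6)[OF k False] and inv = inv[OF k] and a1 = a(1)
    show ?thesis
    proof (cases "cw n k = l")
      case True
      then show ?thesis using False a e(1,2) inv a1 l by (simp add: e'_def i'_def)
    next
      case False': False
      have "\<zeta>[l := i] ! cw n k = \<zeta> ! cw n k" using False' by simp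
      then show ?thesis using False False' a e(4,5)[OF k False'] inv a1 a01[OF k]
        by (auto simp: e'_def)
    qed
  qed
  moreover have "e' j = i" using a(3) i by (simp add: e'_def i_def)
  ultimately show ?case using \<open>length \<zeta> = n\<close> by (auto simp: push i_def[symmetric])
qed

lemma bell_pushes:
  assumes "length \<eta> = n" "j < n" "\<exists>k<n. \<eta> ! k = 0"
  obtains e where "length (bell j \<eta>) = n" "pushes n j (nth \<eta>) e (nth (bell j \<eta>))"
proof (cases "\<eta> ! j = 0")
  case True
  then show ?thesis using that[of "\<lambda>_. 0"] assms by (simp add: bell_def pushes_def)
next
  case False
  then obtain e where e: "length (push \<eta> j (\<eta> ! j)) = n" "e j = \<eta> ! j"
    "\<forall>k<n. if cw n k = j then e k = 0
       else push \<eta> j (\<eta> ! j) ! cw n k = max (\<eta> ! cw n k) (e k) \<and> e (cw n k) = min (\<eta> ! cw n k) (e k)"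
    using push_carry[OF assms] by auto
  have "pushes n j (nth \<eta>) e (nth (bell j \<eta>))"
    using e assms(2) False by (simp add: pushes_def bell_def)
  then show ?thesis using that[of e] e False by (simp add: bell_def)
qed

text \<open>Read as a list, \<open>f\<close> is a configuration with a vacancy, and
  \<open>bell\<close> constructs the carry.\<close>

lemma pushes_exists:
  assumes "j < n" "\<exists>k<n. f k = 0"
  obtains e g where "pushes n j f e g"
proof -
  have "\<exists>k<n. map f [0..<n] ! k = 0" using assms by auto
  then obtain e where "pushes n j (nth (map f [0..<n])) e (nth (bell j (map f [0..<n])))"
    using bell_pushes[of "map f [0..<n]" n j] assms by auto
  then have "pushes n j f e (nth (bell j (map f [0..<n])))"
    using assms(1) by (auto simp: pushes_def)
  then show thesis using that by blast
qed

lemma pushes_cong: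
  assumes "pushes n j f e g" "j < n" "\<And>k. k < n \<Longrightarrow> f k = f' k" "\<And>k. k < n \<Longrightarrow> g k = g' k"
  shows "pushes n j f' e g'"
  using assms by (auto simp: pushes_def)

section \<open>The one-species bell of a single row and its inversion\<close>

definition slide :: "nat \<Rightarrow> nat set \<Rightarrow> nat \<Rightarrow> nat" where
  "slide n C j = first_from n j (\<lambda>k. k \<notin> C)"

definition row_bell :: "nat \<Rightarrow> nat set \<Rightarrow> nat \<Rightarrow> nat set" where
  "row_bell n C j = (if j \<in> C then insert (slide n C j) (C - {j}) else C)"

lemma slide_less: "j < n \<Longrightarrow> slide n C j < n"
  by (simp add: slide_def first_from_less)

lemma ex_vacancy:
  assumes "C \<subseteq> {..<n}" "card C < n"
  shows "\<exists>k<n. k \<notin> C"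
proof (rule ccontr)
  assume "\<not> ?thesis"
  then have "C = {..<n}" using assms(1) by auto
  then show False using assms(2) by simp
qed

lemma slide_notin:
  assumes "C \<subseteq> {..<n}" "card C < n" "j < n"
  shows "slide n C j \<notin> C"
  unfolding slide_def using first_from_sat[OF assms(3) ex_vacancy[OF assms(1,2)]] .

text \<open>A bell at a vacancy moves nothing and is passed on to the row above in the same
  column.\<close>

lemma slide_eq: "j < n \<Longrightarrow> j \<notin> C \<Longrightarrow> slide n C j = j"
  by (simp add: slide_def first_from_def Least_eq_0)

text \<open>The arc indicator of the search for a vacancy serves as the carry. The two clauses on
  \<open>slide\<close> are what \<open>queue_pushes\<close> requires of \<open>l\<close>.\<close>

lemma row_bell_arc:
  assumes C: "C \<subseteq> {..<n}" "card C < n" and j: "j < n"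
  obtains e where "pushes n j (\<lambda>k. of_bool (k \<in> C)) e (\<lambda>k. of_bool (k \<in> row_bell n C j))"
    "slide n C j = j \<longleftrightarrow> j \<notin> C"
    "\<And>k. k < n \<Longrightarrow> cw n k \<noteq> j \<Longrightarrow> cw n k = slide n C j \<longleftrightarrow> e k = 1 \<and> cw n k \<notin> C"
proof -
  let ?l = "slide n C j"
  obtain e :: "nat \<Rightarrow> nat" where e: "?l \<notin> C" "?l = j \<longleftrightarrow> j \<notin> C" "e j = of_bool (\<not> j \<notin> C)"
    "\<And>k. k < n \<Longrightarrow> cw n k = j \<Longrightarrow> e k = 0"
    "\<And>k. k < n \<Longrightarrow> cw n k \<noteq> j \<Longrightarrow> e (cw n k) = of_bool (e k = 1 \<and> \<not> cw n k \<notin> C)"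
    "\<And>k. k < n \<Longrightarrow> cw n k \<noteq> j \<Longrightarrow> cw n k = ?l \<longleftrightarrow> e k = 1 \<and> cw n k \<notin> C"
    unfolding slide_def by (rule first_from_arc[OF j ex_vacancy[OF C]]) blast
  have e01: "e k = 0 \<or> e k = 1" if "k < n" for k
    using j that by (induction rule: ring_induct) (use e in auto)
  have "if cw n k = j then e k = 0 \<and> of_bool (j \<in> row_bell n C j) = (0::nat) \<and> e j = of_bool (j \<in> C)
    else of_bool (cw n k \<in> row_bell n C j) = max (of_bool (cw n k \<in> C)) (e k) \<and>
      e (cw n k) = min (of_bool (cw n k \<in> C)) (e k)" if k: "k < n" for k
  proof (cases "cw n k = j")
    case True
    then show ?thesis using e(2,3,4) k by (auto simp: row_bell_def)
  next
    case False
    have "e k = 1 \<Longrightarrow> j \<in> C" 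
    proof (rule ccontr)
      assume "e k = 1" "j \<notin> C"
      have "e k = 0" using j k by (induction rule: ring_induct) (use e \<open>j \<notin> C\<close> in auto)
      then show False using \<open>e k = 1\<close> by simp
    qed
    then show ?thesis using e(1,5,6) e01[OF k] k False by (auto simp: row_bell_def)
  qed
  then show thesis using that[of e] e by (simp add: pushes_def)
qed

lemma row_bell_subset: "C \<subseteq> {..<n} \<Longrightarrow> j < n \<Longrightarrow> row_bell n C j \<subseteq> {..<n}"
  using slide_less[of j n C] by (auto simp: row_bell_def)

lemma card_row_bell:
  assumes "C \<subseteq> {..<n}" "card C < n" "j < n"
  shows "card (row_bell n C j) = card C"
proof -
  have "finite C" using assms(1) finite_subset by blast
  then show ?thesis using slide_notin[OF assms] card_Suc_Diff1[of C j] by (auto simp: row_bell_def)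
qed

text \<open>One factor \<open>x j\<close> is traded for \<open>x (slide n C j)\<close>; for a vacant
  \<open>j\<close> the two agree.\<close>

lemma prod_row_bell:
  fixes x :: "nat \<Rightarrow> real"
  assumes "C \<subseteq> {..<n}" "card C < n" "j < n"
  shows "(\<Prod>i\<in>row_bell n C j. x i) * x j = (\<Prod>i\<in>C. x i) * x (slide n C j)"
proof (cases "j \<in> C")
  case True
  have "finite C" using assms(1) finite_subset by blast
  then show ?thesis using slide_notin[OF assms] True
    by (simp add: row_bell_def prod.remove[of C j])
next
  case False
  then show ?thesis using slide_eq assms by (simp add: row_bell_def)
qed

text \<open>If the resting column is vacant in the new row, nothing moved and the bell rang there.
  Otherwise a particle arrived there, and its origin is the nearest vacancy of the new row
  counterclockwise from the resting column.\<close>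

lemma row_bell_inj:
  assumes C: "C \<subseteq> {..<n}" "card C < n" "j < n" and D: "D \<subseteq> {..<n}" "card D < n" "i < n"
    and eq: "row_bell n C j = row_bell n D i" "slide n C j = slide n D i"
  shows "C = D \<and> j = i"
proof -
  let ?l = "slide n C j" and ?B = "row_bell n C j"
  have l: "?l \<notin> C" "?l \<notin> D" using slide_notin[OF C] slide_notin[OF D] eq by auto
  show ?thesis
  proof (cases "?l \<in> ?B")
    case False
    then have "j \<notin> C" "i \<notin> D" using eq by (auto simp: row_bell_def)
    then show ?thesis using slide_eq[OF C(3)] slide_eq[OF D(3)] eq by (simp add: row_bell_def)
  next
    case True
    then have jC: "j \<in> C" "i \<in> D" using l eq by (auto simp: row_bell_def split: if_splits)
    then have B: "?B = insert ?l (C - {j})" "?B = insert ?l (D - {i})" using eq by (auto simp: row_bell_def)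
    obtain e where e: "pushes n j (\<lambda>k. of_bool (k \<in> C)) e (\<lambda>k. of_bool (k \<in> ?B))"
      "\<And>k. k < n \<Longrightarrow> cw n k \<noteq> j \<Longrightarrow> cw n k = ?l \<longleftrightarrow> e k = 1 \<and> cw n k \<notin> C"
      using row_bell_arc[OF C] by metis
    obtain e' where e': "pushes n i (\<lambda>k. of_bool (k \<in> D)) e' (\<lambda>k. of_bool (k \<in> row_bell n D i))"
      "\<And>k. k < n \<Longrightarrow> cw n k \<noteq> i \<Longrightarrow> cw n k = ?l \<longleftrightarrow> e' k = 1 \<and> cw n k \<notin> D"
      using row_bell_arc[OF D] eq by metis
    have inC: "e k \<le> of_bool (k \<in> C)" if "k < n" for k
      using C(3) that by (induction rule: ring_induct) (use pushesD[OF e(1)] pushes_start[OF e(1) C(3)] in auto)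
    have inD: "e' k \<le> of_bool (k \<in> D)" if "k < n" for k
      using D(3) that by (induction rule: ring_induct) (use pushesD[OF e'(1)] pushes_start[OF e'(1) D(3)] in auto)
    have ji: "j = i"
    proof (rule ccontr)
      assume "j \<noteq> i"
      have ne: "j \<noteq> ?l" "i \<noteq> ?l" using l jC by metis+
      have nin: "j \<notin> ?B" "i \<notin> ?B"
        subgoal unfolding B(1) using ne by simp
        subgoal unfolding B(2) using ne by simp
        done
      have sub: "C - {j} \<subseteq> ?B" "D - {i} \<subseteq> ?B" using B by blast+
      \<comment> \<open>Each starting column is vacant in the other row, so either carry is 0 where
        the other starts. They never coexist, although both should be present on entering the
        resting column.\<close>
      have disj: "e k = 0 \<or> e' k = 0" if "k < n" for k
        using C(3) that
      proof (induction rule: ring_induct)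
        case start
        have "j \<notin> D" using nin sub \<open>j \<noteq> i\<close> by blast
        then show ?case using inD[OF C(3)] by simp
      next
        case (step k)
        show ?case
        proof (cases "cw n k = i")
          case True
          have "i \<notin> C" using nin sub \<open>j \<noteq> i\<close> by blast
          then show ?thesis using inC[OF D(3)] True by simp
        next
          case False
          then show ?thesis using step pushesD(5)[OF e(1), of k] pushesD(5)[OF e'(1), of k] by auto
        qed
      qed
      obtain k where k: "k < n" "cw n k = ?l" using ring_pred slide_less[OF C(3)] by blast
      then show False using e(2)[OF k(1)] e'(2)[OF k(1)] disj[OF k(1)] ne by auto
    qed
    have "C = insert j (?B - {?l})" using B(1) l jC by blast
    also have "\<dots> = D" using B(2) l jC ji by blast
    finally show ?thesis using ji by simp
  qed
qed

section \<open>The bells of multiline diagrams\<close>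

text \<open>The value at \<open>r\<close> is the column that rings in row \<open>Suc r\<close>; the
  value at \<open>s\<close> is where the bell leaves the top row.\<close>

fun trail :: "nat \<Rightarrow> (nat \<Rightarrow> nat set) \<Rightarrow> nat \<Rightarrow> nat \<Rightarrow> nat" where
  "trail n \<xi> j 0 = j"
| "trail n \<xi> j (Suc r) = slide n (\<xi> (Suc r)) (trail n \<xi> j r)"

text \<open>
  The bell of column \<open>j\<close> first moves a particle in row \<open>1\<close>; the column where that particle comes to
  rest is the one whose bell rings in row \<open>2\<close>, and so on upwards.
\<close>

definition diagram_bell :: "nat \<Rightarrow> nat \<Rightarrow> (nat \<Rightarrow> nat set) \<Rightarrow> nat \<Rightarrow> (nat \<Rightarrow> nat set)" where
  "diagram_bell n s \<xi> j = (\<lambda>r\<in>{1..s}. row_bell n (\<xi> r) (trail n \<xi> j (r - 1)))"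

definition labels :: "nat \<Rightarrow> nat \<Rightarrow> (nat \<Rightarrow> nat set) \<Rightarrow> nat \<Rightarrow> nat \<Rightarrow> nat" where
  "labels n s \<xi> r = foldr (\<lambda>r. label_row n s r (\<xi> r)) [r..<Suc s] (\<lambda>_. 0)"

lemma labels_top: "labels n s \<xi> (Suc s) = (\<lambda>_. 0)"
  by (simp add: labels_def)

lemma labels_step: "r \<le> s \<Longrightarrow> labels n s \<xi> r = label_row n s r (\<xi> r) (labels n s \<xi> (Suc r))"
  unfolding labels_def by (subst upt_conv_Cons) auto

lemma bottom_labels_eq: "bottom_labels n s \<xi> = map (labels n s \<xi> 1) [0..<n]"
  by (simp add: bottom_labels_def labels_def)

lemma trail_less: "j < n \<Longrightarrow> trail n \<xi> j r < n"
  by (induction r) (auto simp: slide_less)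

lemma queue_threshold_card:
  assumes "queue n (\<lambda>k. of_bool (P k)) c (\<lambda>k. of_bool (Q k))"
  shows "card {k. k < n \<and> Q k} = card {k. k < n \<and> P k}"
  using queue_sum[OF assms] unfolding sum_of_bool_lessThan .

lemma sum_atLeastAtMost_head: "(r::nat) \<le> s \<Longrightarrow> (\<Sum>i=r..s. m i) = m r + (\<Sum>i=Suc r..s. m i :: nat)"
  by (rule sum.atLeast_Suc_atMost)

section \<open>Labels of diagrams with a fixed content\<close>

locale multiline =
  fixes n s :: nat and m :: "nat \<Rightarrow> nat"
  assumes n_eq: "n = (\<Sum>r\<le>s. m r)" and vacancy: "m 0 \<ge> 1"
begin

lemma n_eq': "n = m 0 + (\<Sum>i=1..s. m i)"
  using n_eq sum_atLeastAtMost_head[of 0 s m] by (simp add: atMost_atLeast0)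

text \<open>The sites counted by \<open>m 0\<close> leave a vacancy in every row, where a moving
  particle can stop.\<close>

lemma row_size_less: "1 \<le> r \<Longrightarrow> (\<Sum>i=r..s. m i) < n"
proof -
  assume "1 \<le> r"
  then have "(\<Sum>i=r..s. m i) \<le> (\<Sum>i=1..s. m i)" by (intro sum_mono2) auto
  then show ?thesis using n_eq' vacancy by simp
qed

lemma diagramsD:
  assumes "\<xi> \<in> diagrams n s m" "r \<in> {1..s}"
  shows "\<xi> r \<subseteq> {..<n}" "card (\<xi> r) = (\<Sum>i=r..s. m i)" "card (\<xi> r) < n"
proof -
  show "\<xi> r \<subseteq> {..<n}" and c: "card (\<xi> r) = (\<Sum>i=r..s. m i)"
    using assms by (auto simp: diagrams_def dest!: PiE_mem)
  show "card (\<xi> r) < n" unfolding c using row_size_less assms(2) by simp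
qed

lemma labels_row:
  assumes \<xi>: "\<xi> \<in> diagrams n s m" "r \<in> {1..s}"
    and L: "\<forall>k<n. labels n s \<xi> (Suc r) k \<le> s \<and> (labels n s \<xi> (Suc r) k \<noteq> 0 \<longrightarrow> r < labels n s \<xi> (Suc r) k)"
    and card: "card {k. k < n \<and> Suc r \<le> labels n s \<xi> (Suc r) k} = (\<Sum>i=Suc r..s. m i)"
  shows "0 < t \<Longrightarrow> r < t \<Longrightarrow> queue n (\<lambda>k. of_bool (t \<le> labels n s \<xi> (Suc r) k))
      (\<lambda>k. of_bool (k \<in> \<xi> r)) (\<lambda>k. of_bool (t \<le> labels n s \<xi> r k))"
    and "0 < t \<Longrightarrow> t \<le> r \<Longrightarrow> k < n \<Longrightarrow> t \<le> labels n s \<xi> r k \<longleftrightarrow> k \<in> \<xi> r"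
    and "k < n \<Longrightarrow> labels n s \<xi> r k \<noteq> 0 \<Longrightarrow> r \<le> labels n s \<xi> r k"
    and "k < n \<Longrightarrow> r \<le> s \<Longrightarrow> labels n s \<xi> r k \<le> s"
proof -
  let ?L = "labels n s \<xi> (Suc r)"
  note row = diagramsD[OF \<xi>]
  have D: "labels n s \<xi> r = label_row n s r (\<xi> r) ?L" using labels_step \<xi>(2) by simp
  have "{k. k < n \<and> 0 < ?L k} = {k. k < n \<and> Suc r \<le> ?L k}" using L by fastforce
  then have "card {k. k < n \<and> 0 < ?L k} \<le> card (\<xi> r)"
    using card row(2) sum_atLeastAtMost_head[of r s m] \<xi>(2) by simp
  note lr = label_row[OF row(1) L this, folded D]
  show "0 < t \<Longrightarrow> r < t \<Longrightarrow> queue n (\<lambda>k. of_bool (t \<le> labels n s \<xi> (Suc r) k))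
      (\<lambda>k. of_bool (k \<in> \<xi> r)) (\<lambda>k. of_bool (t \<le> labels n s \<xi> r k))"
    and "0 < t \<Longrightarrow> t \<le> r \<Longrightarrow> k < n \<Longrightarrow> t \<le> labels n s \<xi> r k \<longleftrightarrow> k \<in> \<xi> r"
    and "k < n \<Longrightarrow> labels n s \<xi> r k \<noteq> 0 \<Longrightarrow> r \<le> labels n s \<xi> r k"
    and "k < n \<Longrightarrow> r \<le> s \<Longrightarrow> labels n s \<xi> r k \<le> s"
    by (fact lr)+
qed

text \<open>Downward induction on rows: a queue preserves the counts at thresholds above
  \<open>r\<close>, and threshold \<open>r\<close> counts the whole row. These counts guarantee that
  the next row has room for all matchings.\<close>

lemma labels_bounds:
  assumes "\<xi> \<in> diagrams n s m" "1 \<le> r" "r \<le> Suc s"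
  shows "(\<forall>k<n. labels n s \<xi> r k \<le> s \<and> (labels n s \<xi> r k \<noteq> 0 \<longrightarrow> r \<le> labels n s \<xi> r k)) \<and>
    (\<forall>t\<ge>r. card {k. k < n \<and> t \<le> labels n s \<xi> r k} = (\<Sum>i=t..s. m i))"
  using assms(3)
proof (induction rule: inc_induct)
  case base
  then show ?case by (auto simp: labels_top)
next
  case (step r)
  have r: "r \<in> {1..s}" using step.hyps assms(2) by simp
  note \<xi> = diagramsD[OF assms(1) r]
  have "\<forall>k<n. labels n s \<xi> (Suc r) k \<le> s \<and> (labels n s \<xi> (Suc r) k \<noteq> 0 \<longrightarrow> r < labels n s \<xi> (Suc r) k)"
    "card {k. k < n \<and> Suc r \<le> labels n s \<xi> (Suc r) k} = (\<Sum>i=Suc r..s. m i)"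
    using step.IH by (auto simp: Suc_le_eq)
  note lr = labels_row[OF assms(1) r this]
  have "card {k. k < n \<and> t \<le> labels n s \<xi> r k} = (\<Sum>i=t..s. m i)" if "r \<le> t" for t
  proof (cases "r = t")
    case True
    have "{k. k < n \<and> t \<le> labels n s \<xi> r k} = \<xi> r" using lr(2)[of t] True r \<xi>(1) by auto
    then show ?thesis using \<xi>(2) True by simp
  next
    case False
    then have "r < t" "0 < t" using that by auto
    from queue_threshold_card[OF lr(1)[OF this(2,1)]] show ?thesis using step.IH \<open>r < t\<close> by simp
  qed
  then show ?case using lr(3,4) r by auto
qed

lemma label_row_labels:
  assumes "\<xi> \<in> diagrams n s m" "r \<in> {1..s}" "0 < t"
  shows "r < t \<Longrightarrow> queue n (\<lambda>k. of_bool (t \<le> labels n s \<xi> (Suc r) k)) (\<lambda>k. of_bool (k \<in> \<xi> r))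
      (\<lambda>k. of_bool (t \<le> labels n s \<xi> r k))"
    and "t \<le> r \<Longrightarrow> k < n \<Longrightarrow> t \<le> labels n s \<xi> r k \<longleftrightarrow> k \<in> \<xi> r"
proof -
  have "\<forall>k<n. labels n s \<xi> (Suc r) k \<le> s \<and> (labels n s \<xi> (Suc r) k \<noteq> 0 \<longrightarrow> r < labels n s \<xi> (Suc r) k)"
    "card {k. k < n \<and> Suc r \<le> labels n s \<xi> (Suc r) k} = (\<Sum>i=Suc r..s. m i)"
    using labels_bounds[OF assms(1), of "Suc r"] assms(2) by (auto simp: Suc_le_eq)
  note lr = labels_row[OF assms(1,2) this]
  show "r < t \<Longrightarrow> queue n (\<lambda>k. of_bool (t \<le> labels n s \<xi> (Suc r) k)) (\<lambda>k. of_bool (k \<in> \<xi> r))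
      (\<lambda>k. of_bool (t \<le> labels n s \<xi> r k))"
    using lr(1)[OF assms(3)] .
  show "t \<le> r \<Longrightarrow> k < n \<Longrightarrow> t \<le> labels n s \<xi> r k \<longleftrightarrow> k \<in> \<xi> r"
    using lr(2)[OF assms(3)] .
qed

lemma diagram_bell_row: "r \<in> {1..s} \<Longrightarrow> diagram_bell n s \<xi> j r = row_bell n (\<xi> r) (trail n \<xi> j (r - 1))"
  by (simp add: diagram_bell_def)

lemma diagram_bell_diagrams:
  assumes "\<xi> \<in> diagrams n s m" "j < n"
  shows "diagram_bell n s \<xi> j \<in> diagrams n s m"
  unfolding diagrams_def
proof (rule PiE_I)
  fix r assume r: "r \<in> {1..s}"
  note \<xi> = diagramsD[OF assms(1) r]
  show "diagram_bell n s \<xi> j r \<in> {C. C \<subseteq> {..<n} \<and> card C = (\<Sum>i=r..s. m i)}"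
    using row_bell_subset[OF \<xi>(1)] card_row_bell[OF \<xi>(1,3)] \<xi>(2) trail_less[OF assms(2)]
    by (auto simp: diagram_bell_row[OF r])
qed (auto simp: diagram_bell_def restrict_def)

text \<open>Downward induction from the empty row above the top. The labels after a bell are
  compared with the labels of the moved diagram one threshold at a time.\<close>

lemma labels_diagram_bell:
  assumes \<xi>: "\<xi> \<in> diagrams n s m" and j: "j < n" and r1: "1 \<le> r" and "r \<le> Suc s"
  shows "\<exists>e. pushes n (trail n \<xi> j (r - 1)) (labels n s \<xi> r) e (labels n s (diagram_bell n s \<xi> j) r)"
  using \<open>r \<le> Suc s\<close>
proof (induction rule: inc_induct)
  case base
  show ?case by (intro exI[of _ "\<lambda>_. 0"]) (simp add: pushes_def labels_top)
next
  case (step r)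
  let ?\<xi>' = "diagram_bell n s \<xi> j"
  let ?L = "labels n s \<xi> (Suc r)" and ?D = "labels n s \<xi> r"
    and ?L' = "labels n s ?\<xi>' (Suc r)" and ?D' = "labels n s ?\<xi>' r"
  define i where "i = trail n \<xi> j (r - 1)"
  define l where "l = slide n (\<xi> r) i"
  have r: "r \<in> {1..s}" using step.hyps r1 by simp
  have i: "i < n" unfolding i_def by (rule trail_less[OF j])
  have l: "l < n" unfolding l_def by (rule slide_less[OF i])
  have lt: "l = trail n \<xi> j r" using r by (cases r) (simp_all add: l_def i_def)
  note row = diagramsD[OF \<xi> r]
  note \<xi>' = diagram_bell_diagrams[OF \<xi> j]
  have row': "?\<xi>' r = row_bell n (\<xi> r) i" using diagram_bell_row[OF r] by (simp add: i_def)
  obtain eA where pA: "pushes n l ?L eA ?L'" using step.IH lt by auto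
  obtain k where "k < n" "k \<notin> \<xi> r" using ex_vacancy[OF row(1,3)] by blast
  then have "\<exists>k<n. ?D k = 0"
    using label_row_labels(2)[OF \<xi> r, of 1 k] r by (intro exI[of _ k]) auto
  then obtain e g where pD: "pushes n i ?D e g" using pushes_exists[OF i] by metis
  obtain eC where eC: "pushes n i (\<lambda>k. of_bool (k \<in> \<xi> r)) eC (\<lambda>k. of_bool (k \<in> ?\<xi>' r))"
    "l = i \<longleftrightarrow> i \<notin> \<xi> r"
    "\<And>k. k < n \<Longrightarrow> cw n k \<noteq> i \<Longrightarrow> cw n k = l \<longleftrightarrow> eC k = 1 \<and> cw n k \<notin> \<xi> r"
    unfolding row' l_def by (rule row_bell_arc[OF row(1,3) i]) blast
  have thr: "t \<le> g k \<longleftrightarrow> t \<le> ?D' k" if t: "0 < t" and k: "k < n" for t k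
  proof -
    note pDt = pushes_threshold[OF pD t]
    show ?thesis
    proof (cases "r < t")
      case True
      \<comment> \<open>Above \<open>r\<close> the interchange law applies, the arrivals being
        pushed at \<open>l\<close> by the induction hypothesis; departures are unique.\<close>
      have "queue n (\<lambda>k. of_bool (t \<le> ?L' k)) (\<lambda>k. of_bool (k \<in> ?\<xi>' r)) (\<lambda>k. of_bool (t \<le> g k))"
        by (rule queue_pushes[OF label_row_labels(1)[OF \<xi> r t True] i l _ _ pDt eC(1) pushes_threshold[OF pA t]])
          (use eC(2,3) in auto)
      from queue_unique[OF this label_row_labels(1)[OF \<xi>' r t True] k] show ?thesis
        by (simp add: of_bool_eq_iff)
    next
      case False
      \<comment> \<open>Up to \<open>r\<close> the threshold sees the entire row, which moves by
        \<open>row_bell\<close>.\<close>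
      have "pushes n i (\<lambda>k. of_bool (k \<in> \<xi> r)) (\<lambda>k. of_bool (t \<le> e k)) (\<lambda>k. of_bool (t \<le> g k))"
        by (rule pushes_cong[OF pDt i]) (use label_row_labels(2)[OF \<xi> r t] False in auto)
      from pushes_unique[OF this eC(1) i k] show ?thesis
        using label_row_labels(2)[OF \<xi>' r t _ k] False by (simp add: of_bool_eq_iff)
    qed
  qed
  have "g k = ?D' k" if k: "k < n" for k
    using thr[OF _ k, of "g k"] thr[OF _ k, of "?D' k"]
    by (cases "g k = 0"; cases "?D' k = 0") auto
  then have "pushes n i ?D e ?D'" by (intro pushes_cong[OF pD i]) auto
  then show ?case unfolding i_def by blast
qed

section \<open>Projection of diagrams and their bells to configurations\<close>

lemma count_content: "count (\<Sum>r\<le>s. replicate_mset (m r) r) a = (if a \<le> s then m a else 0)"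
  by (simp add: count_sum if_distrib sum.delta cong: if_cong)

text \<open>The multiplicity of a label is the difference of two consecutive threshold
  counts.\<close>

lemma bottom_labels_configs:
  assumes "\<xi> \<in> diagrams n s m"
  shows "bottom_labels n s \<xi> \<in> configs s m"
proof -
  let ?f = "labels n s \<xi> 1"
  have B: "?f k \<le> s" if "k < n" for k using labels_bounds[OF assms, of 1] that by auto
  have T: "card {k. k < n \<and> t \<le> ?f k} = (\<Sum>i=t..s. m i)" if "1 \<le> t" for t
    using labels_bounds[OF assms, of 1] that by auto
  have U: "card {k. k < n \<and> ?f k = a} + (card {k. k < n \<and> Suc a \<le> ?f k}) = card {k. k < n \<and> a \<le> ?f k}" for a
    by (subst card_Un_disjoint[symmetric]) (auto intro!: arg_cong[of _ _ card])
  have "card {k. k < n \<and> ?f k = a} = (if a \<le> s then m a else 0)" for a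
  proof (cases "a \<le> s")
    case True
    show ?thesis
    proof (cases "a = 0")
      case True
      then show ?thesis using U[of 0] T[of 1] n_eq' by simp
    next
      case False
      then show ?thesis using U[of a] T[of a] T[of "Suc a"] True sum_atLeastAtMost_head[of a s m] by simp
    qed
  next
    case False
    then have "{k. k < n \<and> ?f k = a} = {}" using B by auto
    then show ?thesis using False by simp
  qed
  moreover have "count (mset (bottom_labels n s \<xi>)) a = card {k. k < n \<and> ?f k = a}" for a
  proof -
    have "count (mset (map ?f xs)) a = length (filter (\<lambda>k. ?f k = a) xs)" for xs
      by (induction xs) auto
    then have "count (mset (bottom_labels n s \<xi>)) a = card (set (filter (\<lambda>k. ?f k = a) [0..<n]))"
      unfolding bottom_labels_eq distinct_card[OF distinct_filter[OF distinct_upt]] .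
    also have "set (filter (\<lambda>k. ?f k = a) [0..<n]) = {k. k < n \<and> ?f k = a}" by auto
    finally show ?thesis .
  qed
  ultimately have "mset (bottom_labels n s \<xi>) = (\<Sum>r\<le>s. replicate_mset (m r) r)"
    by (intro multiset_eqI) (simp add: count_content)
  then show ?thesis by (simp add: configs_def permutations_of_multiset_def)
qed

lemma configs_mset: "\<eta> \<in> configs s m \<longleftrightarrow> mset \<eta> = (\<Sum>r\<le>s. replicate_mset (m r) r)"
  by (simp add: configs_def permutations_of_multiset_def)

lemma configs_length: "\<eta> \<in> configs s m \<Longrightarrow> length \<eta> = n"
proof -
  assume "\<eta> \<in> configs s m"
  then have "size (mset \<eta>) = size (\<Sum>r\<le>s. replicate_mset (m r) r)" unfolding configs_mset by simp
  then show ?thesis by (simp add: n_eq size_multiset_sum)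
qed

lemma configs_vacancy:
  assumes "\<eta> \<in> configs s m"
  shows "\<exists>k<n. \<eta> ! k = 0"
proof -
  have "count (mset \<eta>) 0 = m 0" using assms count_content[of 0] unfolding configs_mset by simp
  then have "0 \<in> set \<eta>" using vacancy by (metis count_mset_0_iff not_one_le_zero)
  then show ?thesis using configs_length[OF assms] by (simp add: in_set_conv_nth)
qed

text \<open>In row 1 the trail is still at \<open>j\<close>, and \<open>pushes\<close> determines
  the outcome of a bell.\<close>

lemma bottom_labels_diagram_bell:
  assumes "\<xi> \<in> diagrams n s m" "j < n"
  shows "bottom_labels n s (diagram_bell n s \<xi> j) = bell j (bottom_labels n s \<xi>)"
proof -
  let ?\<eta> = "bottom_labels n s \<xi>" and ?\<zeta> = "bottom_labels n s (diagram_bell n s \<xi> j)"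
  have len: "length ?\<eta> = n" "length ?\<zeta> = n" by (simp_all add: bottom_labels_eq)
  obtain e where e: "length (bell j ?\<eta>) = n" "pushes n j (nth ?\<eta>) e (nth (bell j ?\<eta>))"
    using bell_pushes[OF len(1) assms(2) configs_vacancy[OF bottom_labels_configs[OF assms(1)]]] .
  obtain e' where "pushes n j (labels n s \<xi> 1) e' (labels n s (diagram_bell n s \<xi> j) 1)"
    using labels_diagram_bell[OF assms, of 1] by auto
  then have "pushes n j (nth ?\<eta>) e' (nth ?\<zeta>)"
    by (rule pushes_cong) (auto simp: bottom_labels_eq assms(2))
  from pushes_unique[OF this e(2) assms(2)] show ?thesis
    by (intro nth_equalityI) (auto simp: len e(1))
qed

lemma bell_configs:
  assumes "\<eta> \<in> configs s m" "j < n"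
  shows "bell j \<eta> \<in> configs s m"
proof -
  note len = configs_length[OF assms(1)]
  obtain e where e: "length (bell j \<eta>) = n" "pushes n j (nth \<eta>) e (nth (bell j \<eta>))"
    using bell_pushes[OF len assms(2) configs_vacancy[OF assms(1)]] .
  have *: "image_mset (nth \<zeta>) (mset_set {..<length \<zeta>}) = mset \<zeta>" for \<zeta> :: "nat list"
    by (metis atLeast_upt map_nth mset_map mset_set_set distinct_upt)
  show ?thesis using pushes_mset[OF e(2)] *[of \<eta>] *[of "bell j \<eta>"] len e(1) assms(1)
    unfolding configs_mset by simp
qed

section \<open>Weights, and the bijection on diagrams with a marked column\<close>

lemma wt_eq_prod_rows:
  assumes "\<xi> \<in> diagrams n s m"
  shows "wt n s x \<xi> = (\<Prod>r=1..s. \<Prod>i\<in>\<xi> r. x i)"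
proof -
  have "x i ^ column_count s \<xi> i = (\<Prod>r=1..s. if i \<in> \<xi> r then x i else 1)" for i
    unfolding column_count_def
    by (subst prod.If_cases) (auto simp: Int_def)
  then have "wt n s x \<xi> = (\<Prod>i<n. \<Prod>r=1..s. if i \<in> \<xi> r then x i else 1)"
    by (simp add: wt_def)
  also have "\<dots> = (\<Prod>r=1..s. \<Prod>i<n. if i \<in> \<xi> r then x i else 1)"
    by (rule prod.swap)
  also have "\<dots> = (\<Prod>r=1..s. \<Prod>i\<in>\<xi> r. x i)"
  proof (rule prod.cong[OF refl])
    fix r assume "r \<in> {1..s}"
    from diagramsD(1)[OF assms this] show "(\<Prod>i<n. if i \<in> \<xi> r then x i else 1) = (\<Prod>i\<in>\<xi> r. x i)"
      by (simp add: prod.If_cases Int_absorb1)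
  qed
  finally show ?thesis .
qed

text \<open>Row \<open>r\<close> contributes the ratio of \<open>x\<close> at the trail positions
  \<open>r\<close> and \<open>r - 1\<close>; the product telescopes.\<close>

lemma wt_diagram_bell:
  assumes "\<xi> \<in> diagrams n s m" "j < n"
  shows "wt n s x (diagram_bell n s \<xi> j) * x j = wt n s x \<xi> * x (trail n \<xi> j s)"
proof -
  have "(\<Prod>r=1..k. \<Prod>i\<in>diagram_bell n s \<xi> j r. x i) * x j =
      (\<Prod>r=1..k. \<Prod>i\<in>\<xi> r. x i) * x (trail n \<xi> j k)" if "k \<le> s" for k
    using that
  proof (induction k)
    case (Suc k)
    then have r: "Suc k \<in> {1..s}" by simp
    note \<xi> = diagramsD[OF assms(1) r]
    define P' P R' R where "P' = (\<Prod>r=1..k. \<Prod>i\<in>diagram_bell n s \<xi> j r. x i)"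
      and "P = (\<Prod>r=1..k. \<Prod>i\<in>\<xi> r. x i)" and "R' = (\<Prod>i\<in>diagram_bell n s \<xi> j (Suc k). x i)"
      and "R = (\<Prod>i\<in>\<xi> (Suc k). x i)"
    have IH: "P' * x j = P * x (trail n \<xi> j k)" using Suc by (simp add: P'_def P_def)
    have R: "R' * x (trail n \<xi> j k) = R * x (trail n \<xi> j (Suc k))"
      using prod_row_bell[OF \<xi>(1,3) trail_less[OF assms(2)]] diagram_bell_row[OF r]
      by (simp add: R'_def R_def)
    have "P' * R' * x j = (P' * x j) * R'" by (simp only: mult_ac)
    also have "\<dots> = P * (R' * x (trail n \<xi> j k))" unfolding IH by (simp only: mult_ac)
    also have "\<dots> = P * R * x (trail n \<xi> j (Suc k))" unfolding R by (simp only: mult_ac)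
    finally show ?case by (simp add: P'_def P_def R'_def R_def del: trail.simps)
  qed simp
  from this[of s] show ?thesis
    using wt_eq_prod_rows assms diagram_bell_diagrams by simp
qed

text \<open>The motion is undone from the top: the exit column and the new row \<open>s\<close>
  determine the old row \<open>s\<close> and the column that rang in it, and so on
  downwards.\<close>

lemma diagram_bell_inj:
  assumes \<xi>: "\<xi> \<in> diagrams n s m" "j < n" and \<zeta>: "\<zeta> \<in> diagrams n s m" "i < n"
    and eq: "diagram_bell n s \<xi> j = diagram_bell n s \<zeta> i" "trail n \<xi> j s = trail n \<zeta> i s"
  shows "\<xi> = \<zeta> \<and> j = i"
proof -
  have tr: "trail n \<xi> j r = trail n \<zeta> i r \<and> (\<forall>q\<in>{Suc r..s}. \<xi> q = \<zeta> q)" if "r \<le> s" for r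
    using that
  proof (induction rule: inc_induct)
    case (step r)
    have r: "Suc r \<in> {1..s}" using step by simp
    note a = diagramsD[OF \<xi>(1) r] and b = diagramsD[OF \<zeta>(1) r]
    have "\<xi> (Suc r) = \<zeta> (Suc r) \<and> trail n \<xi> j r = trail n \<zeta> i r"
      by (rule row_bell_inj[OF a(1,3) trail_less[OF \<xi>(2)] b(1,3) trail_less[OF \<zeta>(2)]])
        (use step fun_cong[OF eq(1), of "Suc r"] diagram_bell_row[OF r] in simp_all)
    then show ?case using step by (auto simp: Suc_le_eq le_less) 
  qed (use eq in simp)
  have "\<xi> = \<zeta>"
    using \<xi>(1) \<zeta>(1) tr[of 0] unfolding diagrams_def by (intro PiE_ext) auto
  then show ?thesis using tr[of 0] by simp
qed

lemma bij_diagram_bell: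
  "bij_betw (\<lambda>(\<xi>, j). (diagram_bell n s \<xi> j, trail n \<xi> j s))
     (diagrams n s m \<times> {..<n}) (diagrams n s m \<times> {..<n})" (is "bij_betw ?T ?S ?S")
proof -
  have fin: "finite ?S"
    unfolding diagrams_def by (intro finite_cartesian_product finite_PiE) auto
  moreover have "?T ` ?S \<subseteq> ?S" using diagram_bell_diagrams trail_less by auto
  moreover have "inj_on ?T ?S"
    by (intro inj_onI) (use diagram_bell_inj in auto)
  ultimately show ?thesis by (simp add: bij_betw_def endo_inj_surj)
qed

end

section \<open>Stationarity and uniqueness\<close>

text \<open>The identity is given only for \<open>t \<ge> 0\<close>, so the derivative at 0 is taken
  from the right: drop the constant term, divide by \<open>t > 0\<close>, and let \<open>t\<close>
  tend to 0.\<close>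

lemma constant_powser_coeff1:
  fixes a :: "nat \<Rightarrow> real"
  assumes "\<And>t. 0 \<le> t \<Longrightarrow> (\<lambda>k. a k * t ^ k) sums c"
  shows "a 1 = 0"
proof -
  have a0: "a 0 = c"
    by (rule sums_unique2[OF powser_sums_zero assms[OF order_refl]])
  have pos: "(\<lambda>k. a (Suc k) * t ^ k) sums 0" if "0 < t" for t
  proof -
    have "(\<lambda>k. a k * t ^ k) sums (0 + a 0 * t ^ 0)" using assms[of t] that a0 by simp
    then have "(\<lambda>k. a (Suc k) * t ^ Suc k) sums 0"
      by (rule sums_Suc_iff[of "\<lambda>k. a k * t ^ k", THEN iffD2])
    from sums_divide[OF this, of t] show ?thesis using that by simp
  qed
  define f where "f t = (\<Sum>k. a (Suc k) * t ^ k)" for t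
  have "(f \<longlongrightarrow> a (Suc 0)) (at 0)"
  proof (rule powser_limit_0[of 1 "\<lambda>k. a (Suc k)"])
    \<comment> \<open>Convergence at 1 gives convergence on both sides of 0.\<close>
    show "(\<lambda>k. a (Suc k) * t ^ k) sums f t" if "norm t < 1" for t
      unfolding f_def using powser_inside[of "\<lambda>k. a (Suc k)" 1 t] sums_summable[OF pos[of 1]] that
      by (intro summable_sums) simp
  qed simp
  then have "(f \<longlongrightarrow> a (Suc 0)) (at_right 0)" by (rule filterlim_mono) (auto simp: at_le)
  moreover have "eventually (\<lambda>t. f t = 0) (at_right 0)"
    using eventually_at_right_less[of "0::real"]
    by eventually_elim (simp only: f_def sums_unique[OF pos, symmetric])
  then have "(f \<longlongrightarrow> 0) (at_right 0)" by (rule tendsto_eventually)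
  ultimately have "a (Suc 0) = 0"
    using tendsto_unique[OF trivial_limit_at_right_real] by blast
  then show ?thesis by simp
qed

section \<open>The exponential series of the generator and invariance\<close>

locale push_tasep = multiline +
  fixes x :: "nat \<Rightarrow> real"
  assumes x_pos: "\<And>i. i < n \<Longrightarrow> x i > 0"
begin

lemma finite_configs: "finite (configs s m)"
  by (simp add: configs_def)

lemma finite_diagrams: "finite (diagrams n s m)"
  unfolding diagrams_def by (intro finite_PiE) auto

definition rate :: real where
  "rate = (\<Sum>j<n. 1 / x j)"

lemma rate_nonneg: "0 \<le> rate"
  unfolding rate_def using x_pos by (intro sum_nonneg) (simp add: less_imp_le)

text \<open>Each application of the generator multiplies a uniform bound on
  \<open>configs s m\<close> by at most \<open>2 * rate\<close>, so the exponential series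
  converges.\<close>

lemma generator_pow_bound:
  assumes "\<And>\<eta>. \<eta> \<in> configs s m \<Longrightarrow> \<bar>f \<eta>\<bar> \<le> B" "\<eta> \<in> configs s m"
  shows "\<bar>(generator n x ^^ k) f \<eta>\<bar> \<le> (2 * rate) ^ k * B"
  using assms(2)
proof (induction k arbitrary: \<eta>)
  case (Suc k)
  let ?g = "(generator n x ^^ k) f" and ?b = "(2 * rate) ^ k * B"
  have "\<bar>generator n x ?g \<eta>\<bar> \<le> (\<Sum>j<n. \<bar>1 / x j * (?g (bell j \<eta>) - ?g \<eta>)\<bar>)"
    unfolding generator_def by (rule sum_abs)
  also have "\<dots> \<le> (\<Sum>j<n. 1 / x j * (2 * ?b))"
  proof (rule sum_mono)
    fix j assume "j \<in> {..<n}"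
    then have j: "j < n" by simp
    have "\<bar>?g (bell j \<eta>) - ?g \<eta>\<bar> \<le> 2 * ?b"
      using Suc.IH[OF Suc.prems] Suc.IH[OF bell_configs[OF Suc.prems j]] by linarith
    then show "\<bar>1 / x j * (?g (bell j \<eta>) - ?g \<eta>)\<bar> \<le> 1 / x j * (2 * ?b)"
      using x_pos[OF j] by (simp add: abs_mult divide_right_mono)
  qed
  also have "\<dots> = (2 * rate) ^ Suc k * B"
    unfolding sum_distrib_right[symmetric] rate_def[symmetric] by (simp add: mult_ac)
  finally show ?case by simp
qed (use assms in simp)

lemma summable_transition:
  assumes "\<eta> \<in> configs s m"
  shows "summable (\<lambda>k. t ^ k / fact k * (generator n x ^^ k) (indicator {\<zeta>}) \<eta>)"
proof (rule summable_comparison_test[OF _ summable_exp[of "\<bar>t\<bar> * (2 * rate)"]], intro exI[of _ 0] allI impI)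
  fix k :: nat
  have "\<bar>(generator n x ^^ k) (indicator {\<zeta>}) \<eta>\<bar> \<le> (2 * rate) ^ k * 1"
    by (rule generator_pow_bound[OF _ assms]) (simp add: indicator_def)
  then have "\<bar>t\<bar> ^ k / fact k * \<bar>(generator n x ^^ k) (indicator {\<zeta>}) \<eta>\<bar> \<le> \<bar>t\<bar> ^ k / fact k * (2 * rate) ^ k"
    by (intro mult_left_mono) auto
  then show "norm (t ^ k / fact k * (generator n x ^^ k) (indicator {\<zeta>}) \<eta>) \<le>
      inverse (fact k) * (\<bar>t\<bar> * (2 * rate)) ^ k"
    by (simp add: abs_mult power_abs power_mult_distrib field_simps)
qed

lemma sum_transition_sums:
  "(\<lambda>k. (\<Sum>\<eta>\<in>configs s m. p \<eta> * (generator n x ^^ k) (indicator {\<zeta>}) \<eta>) / fact k * t ^ k) sums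
     (\<Sum>\<eta>\<in>configs s m. p \<eta> * transition_prob n x t \<eta> \<zeta>)"
proof -
  have "(\<lambda>k. \<Sum>\<eta>\<in>configs s m. p \<eta> * (t ^ k / fact k * (generator n x ^^ k) (indicator {\<zeta>}) \<eta>)) sums
     (\<Sum>\<eta>\<in>configs s m. p \<eta> * transition_prob n x t \<eta> \<zeta>)"
    unfolding transition_prob_def
    by (intro sums_sum sums_mult summable_sums summable_transition)
  then show ?thesis
    by (simp add: sum_distrib_left sum_distrib_right sum_divide_distrib mult_ac)
qed

lemma sum_configs_indicator:
  fixes f :: "nat list \<Rightarrow> real"
  assumes "\<zeta> \<in> configs s m"
  shows "(\<Sum>\<eta>\<in>configs s m. f \<eta> * indicator {\<zeta>} \<eta>) = f \<zeta>"
  using assms finite_configs by (simp add: indicator_def if_distrib sum.delta cong: if_cong)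

lemma indicator_singleton_commute: "indicator {a} b = (indicator {b} a :: real)"
  by (simp add: indicator_def eq_commute)

text \<open>The weight may be signed, so differences stay in the class. Testing against all
  \<open>f\<close> makes powers of the generator immediate.\<close>

definition invariant_weight :: "(nat list \<Rightarrow> real) \<Rightarrow> bool" where
  "invariant_weight p \<longleftrightarrow> (\<forall>f. (\<Sum>\<eta>\<in>configs s m. p \<eta> * generator n x f \<eta>) = 0)"

lemma invariant_weightI:
  assumes "\<And>\<zeta>. \<zeta> \<in> configs s m \<Longrightarrow> (\<Sum>\<eta>\<in>configs s m. p \<eta> * generator n x (indicator {\<zeta>}) \<eta>) = 0"
  shows "invariant_weight p"
  unfolding invariant_weight_def
proof
  fix f :: "nat list \<Rightarrow> real"
  have f: "f \<eta> = (\<Sum>\<zeta>\<in>configs s m. f \<zeta> * indicator {\<zeta>} \<eta>)" if "\<eta> \<in> configs s m" for \<eta>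
    unfolding indicator_singleton_commute[of _ \<eta>] by (rule sum_configs_indicator[OF that, symmetric])
  have g: "generator n x f \<eta> = (\<Sum>\<zeta>\<in>configs s m. f \<zeta> * generator n x (indicator {\<zeta>}) \<eta>)"
    if \<eta>: "\<eta> \<in> configs s m" for \<eta>
  proof -
    have "generator n x f \<eta> = (\<Sum>j<n. \<Sum>\<zeta>\<in>configs s m. f \<zeta> * (1 / x j * (indicator {\<zeta>} (bell j \<eta>) - indicator {\<zeta>} \<eta>)))"
      unfolding generator_def
    proof (rule sum.cong[OF refl])
      fix j assume "j \<in> {..<n}"
      then have b: "bell j \<eta> \<in> configs s m" using bell_configs[OF \<eta>] by simp
      have "f (bell j \<eta>) - f \<eta> =
          (\<Sum>\<zeta>\<in>configs s m. f \<zeta> * indicator {\<zeta>} (bell j \<eta>)) - (\<Sum>\<zeta>\<in>configs s m. f \<zeta> * indicator {\<zeta>} \<eta>)"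
        by (rule arg_cong2[OF f[OF b] f[OF \<eta>]])
      also have "\<dots> = (\<Sum>\<zeta>\<in>configs s m. f \<zeta> * (indicator {\<zeta>} (bell j \<eta>) - indicator {\<zeta>} \<eta>))"
        by (simp only: sum_subtractf right_diff_distrib)
      finally show "1 / x j * (f (bell j \<eta>) - f \<eta>) =
          (\<Sum>\<zeta>\<in>configs s m. f \<zeta> * (1 / x j * (indicator {\<zeta>} (bell j \<eta>) - indicator {\<zeta>} \<eta>)))"
        by (simp only: sum_distrib_left mult.left_commute)
    qed
    also have "\<dots> = (\<Sum>\<zeta>\<in>configs s m. \<Sum>j<n. f \<zeta> * (1 / x j * (indicator {\<zeta>} (bell j \<eta>) - indicator {\<zeta>} \<eta>)))"
      by (rule sum.swap)
    finally show ?thesis unfolding generator_def sum_distrib_left .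
  qed
  have "(\<Sum>\<eta>\<in>configs s m. p \<eta> * generator n x f \<eta>) =
      (\<Sum>\<eta>\<in>configs s m. \<Sum>\<zeta>\<in>configs s m. f \<zeta> * (p \<eta> * generator n x (indicator {\<zeta>}) \<eta>))"
    by (rule sum.cong[OF refl]) (simp only: g sum_distrib_left mult.left_commute)
  also have "\<dots> = (\<Sum>\<zeta>\<in>configs s m. f \<zeta> * (\<Sum>\<eta>\<in>configs s m. p \<eta> * generator n x (indicator {\<zeta>}) \<eta>))"
    by (subst sum.swap) (simp only: sum_distrib_left)
  also have "\<dots> = 0" using assms by simp
  finally show "(\<Sum>\<eta>\<in>configs s m. p \<eta> * generator n x f \<eta>) = 0" .
qed

text \<open>Stationarity says that a power series in \<open>t\<close> is constant. Its linear
  coefficient gives invariance; conversely, invariance kills every term of positive order.\<close>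

lemma semigroup_stationary_iff:
  "(\<forall>t\<ge>0. \<forall>\<zeta>\<in>configs s m. (\<Sum>\<eta>\<in>configs s m. p \<eta> * transition_prob n x t \<eta> \<zeta>) = p \<zeta>)
     \<longleftrightarrow> invariant_weight p"
proof
  assume st: "\<forall>t\<ge>0. \<forall>\<zeta>\<in>configs s m. (\<Sum>\<eta>\<in>configs s m. p \<eta> * transition_prob n x t \<eta> \<zeta>) = p \<zeta>"
  show "invariant_weight p"
  proof (rule invariant_weightI)
    fix \<zeta> assume \<zeta>: "\<zeta> \<in> configs s m"
    have "(\<Sum>\<eta>\<in>configs s m. p \<eta> * (generator n x ^^ 1) (indicator {\<zeta>}) \<eta>) / fact 1 = 0"
    proof (rule constant_powser_coeff1)
      fix t :: real assume "0 \<le> t"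
      then show "(\<lambda>k. (\<Sum>\<eta>\<in>configs s m. p \<eta> * (generator n x ^^ k) (indicator {\<zeta>}) \<eta>) / fact k * t ^ k) sums p \<zeta>"
        using sum_transition_sums[of p \<zeta> t] st \<zeta> by simp
    qed
    then show "(\<Sum>\<eta>\<in>configs s m. p \<eta> * generator n x (indicator {\<zeta>}) \<eta>) = 0" by simp
  qed
next
  assume inv: "invariant_weight p"
  show "\<forall>t\<ge>0. \<forall>\<zeta>\<in>configs s m. (\<Sum>\<eta>\<in>configs s m. p \<eta> * transition_prob n x t \<eta> \<zeta>) = p \<zeta>"
  proof (intro allI impI ballI)
    fix t :: real and \<zeta> assume \<zeta>: "\<zeta> \<in> configs s m"
    let ?c = "\<lambda>k. (\<Sum>\<eta>\<in>configs s m. p \<eta> * (generator n x ^^ k) (indicator {\<zeta>}) \<eta>) / fact k * t ^ k"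
    have "?c k = 0" if "k \<noteq> 0" for k
      using inv that by (cases k) (simp_all add: invariant_weight_def)
    then have "?c sums (\<Sum>k\<in>{0}. ?c k)" by (intro sums_finite) auto
    moreover have "(\<Sum>k\<in>{0}. ?c k) = p \<zeta>" using sum_configs_indicator[OF \<zeta>, of p] by simp
    ultimately have "?c sums p \<zeta>" by (simp only:)
    from sums_unique2[OF sum_transition_sums this]
    show "(\<Sum>\<eta>\<in>configs s m. p \<eta> * transition_prob n x t \<eta> \<zeta>) = p \<zeta>" .
  qed
qed

section \<open>Invariance of the projected diagram distribution\<close>

definition multiline_prob :: "nat list \<Rightarrow> real" where
  "multiline_prob \<eta> = (\<Sum>\<xi> | \<xi> \<in> diagrams n s m \<and> bottom_labels n s \<xi> = \<eta>. diagram_prob n s m x \<xi>)"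

lemma sum_multiline_prob:
  "(\<Sum>\<eta>\<in>configs s m. multiline_prob \<eta> * g \<eta>) =
     (\<Sum>\<xi>\<in>diagrams n s m. diagram_prob n s m x \<xi> * g (bottom_labels n s \<xi>))"
proof -
  have "(\<Sum>\<eta>\<in>configs s m. multiline_prob \<eta> * g \<eta>) =
     (\<Sum>\<eta>\<in>configs s m. \<Sum>\<xi> | \<xi> \<in> diagrams n s m \<and> bottom_labels n s \<xi> = \<eta>.
        diagram_prob n s m x \<xi> * g (bottom_labels n s \<xi>))"
    unfolding multiline_prob_def sum_distrib_right by (intro sum.cong refl) auto
  also have "\<dots> = (\<Sum>\<xi>\<in>diagrams n s m. diagram_prob n s m x \<xi> * g (bottom_labels n s \<xi>))"
    by (rule sum.group[OF finite_diagrams finite_configs]) (use bottom_labels_configs in auto)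
  finally show ?thesis .
qed

lemma wt_pos: "0 < wt n s x \<xi>"
  unfolding wt_def using x_pos by (intro prod_pos) simp

lemma partition_fun_pos: "0 < partition_fun n s m x"
proof -
  \<comment> \<open>Filling each row from column 0 shows that a diagram exists.\<close>
  have "(\<lambda>r\<in>{1..s}. {..<\<Sum>i=r..s. m i}) \<in> diagrams n s m"
    unfolding diagrams_def by (auto intro!: less_imp_le[OF row_size_less])
  then show ?thesis unfolding partition_fun_def
    using finite_diagrams wt_pos by (intro sum_pos) auto
qed

lemma multiline_prob_nonneg: "0 \<le> multiline_prob \<eta>"
  unfolding multiline_prob_def diagram_prob_def
  using wt_pos partition_fun_pos by (intro sum_nonneg divide_nonneg_nonneg) (auto simp: less_imp_le)

lemma multiline_prob_sum: "(\<Sum>\<eta>\<in>configs s m. multiline_prob \<eta>) = 1"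
proof -
  have "(\<Sum>\<xi>\<in>diagrams n s m. diagram_prob n s m x \<xi>) = 1"
    unfolding diagram_prob_def sum_divide_distrib[symmetric] partition_fun_def[symmetric]
    using partition_fun_pos by simp
  then show ?thesis using sum_multiline_prob[of "\<lambda>_. 1"] by simp
qed

text \<open>The gain term of a marked diagram is the loss term of its image under the bijection, so
  the two sums cancel.\<close>

lemma multiline_prob_invariant: "invariant_weight multiline_prob"
  unfolding invariant_weight_def
proof
  fix f :: "nat list \<Rightarrow> real"
  let ?S = "diagrams n s m \<times> {..<n}"
  let ?T = "\<lambda>(\<xi>, j). (diagram_bell n s \<xi> j, trail n \<xi> j s)"
  let ?h = "\<lambda>(\<xi>, j). wt n s x \<xi> / x j * f (bottom_labels n s \<xi>)"
  have T: "?h (?T (\<xi>, j)) = wt n s x \<xi> / x j * f (bell j (bottom_labels n s \<xi>))"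
    if "\<xi> \<in> diagrams n s m" "j < n" for \<xi> j
  proof -
    have "wt n s x (diagram_bell n s \<xi> j) / x (trail n \<xi> j s) = wt n s x \<xi> / x j"
      using wt_diagram_bell[OF that, of x] x_pos[OF that(2)] x_pos[OF trail_less[OF that(2), of \<xi> s]]
      by (simp add: frac_eq_eq)
    then show ?thesis by (simp only: prod.case bottom_labels_diagram_bell[OF that])
  qed
  have "(\<Sum>\<xi>\<in>diagrams n s m. wt n s x \<xi> * generator n x f (bottom_labels n s \<xi>)) =
      (\<Sum>(\<xi>, j)\<in>?S. wt n s x \<xi> / x j * f (bell j (bottom_labels n s \<xi>)) - ?h (\<xi>, j))"
    unfolding generator_def sum_distrib_left sum.cartesian_product
    by (intro sum.cong refl) (auto simp: algebra_simps)
  also have "\<dots> = (\<Sum>y\<in>?S. ?h (?T y) - ?h y)"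
    by (intro sum.cong refl) (use T in auto)
  also have "\<dots> = (\<Sum>y\<in>?S. ?h (?T y)) - (\<Sum>y\<in>?S. ?h y)"
    by (rule sum_subtractf)
  also have "(\<Sum>y\<in>?S. ?h (?T y)) = (\<Sum>y\<in>?S. ?h y)"
    by (rule sum.reindex_bij_betw[OF bij_diagram_bell])
  finally have "(\<Sum>\<xi>\<in>diagrams n s m. wt n s x \<xi> * generator n x f (bottom_labels n s \<xi>)) = 0" by simp
  then show "(\<Sum>\<eta>\<in>configs s m. multiline_prob \<eta> * generator n x f \<eta>) = 0"
    unfolding sum_multiline_prob diagram_prob_def
    by (simp add: sum_divide_distrib[symmetric])
qed

section \<open>Uniqueness of the invariant weight\<close>

definition reset_config :: "nat list" where
  "reset_config = rev (sorted_list_of_multiset (\<Sum>r\<le>s. replicate_mset (m r) r))"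

lemma fold_bell_configs: "\<eta> \<in> configs s m \<Longrightarrow> k \<le> n \<Longrightarrow> fold bell [0..<k] \<eta> \<in> configs s m"
  by (induction k) (auto simp: bell_configs)

text \<open>The bell of site \<open>k\<close> extends the decreasing stretch of the first
  \<open>k\<close> sites to \<open>k\<close>.\<close>

lemma fold_bell_decreasing:
  assumes "\<eta> \<in> configs s m" "k \<le> n" "Suc i < k"
  shows "fold bell [0..<k] \<eta> ! Suc i \<le> fold bell [0..<k] \<eta> ! i"
  using assms(2,3)
proof (induction k arbitrary: i)
  case (Suc k)
  let ?\<zeta> = "fold bell [0..<k] \<eta>"
  have k: "k < n" using Suc by simp
  have \<zeta>: "?\<zeta> \<in> configs s m" using fold_bell_configs[OF assms(1)] k by simp
  obtain e where e: "pushes n k (nth ?\<zeta>) e (nth (bell k ?\<zeta>))"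
    using bell_pushes[OF configs_length[OF \<zeta>] k configs_vacancy[OF \<zeta>]] .
  have "bell k ?\<zeta> ! Suc i \<le> bell k ?\<zeta> ! i"
    by (rule pushes_decreasing[OF e k]) (use Suc in auto)
  then show ?case by simp
qed simp

lemma fold_bell_reset:
  assumes "\<eta> \<in> configs s m"
  shows "fold bell [0..<n] \<eta> = reset_config"
proof -
  let ?\<zeta> = "fold bell [0..<n] \<eta>"
  have \<zeta>: "?\<zeta> \<in> configs s m" using fold_bell_configs[OF assms] by simp
  have "sorted_wrt (\<lambda>a b. b \<le> a) ?\<zeta>"
    by (subst sorted_wrt_iff_nth_Suc_transp)
      (use fold_bell_decreasing[OF assms, of n] configs_length[OF \<zeta>] in \<open>auto simp: transp_def\<close>)
  then have "sorted (rev ?\<zeta>)" by (simp add: sorted_wrt_rev)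
  moreover have "mset (rev ?\<zeta>) = (\<Sum>r\<le>s. replicate_mset (m r) r)" using \<zeta> configs_mset by simp
  ultimately have "rev ?\<zeta> = sorted_list_of_multiset (\<Sum>r\<le>s. replicate_mset (m r) r)"
    by (metis sorted_list_of_multiset_mset sorted_sort_id)
  then show ?thesis unfolding reset_config_def by (metis rev_rev_ident)
qed

text \<open>Bells that leave a configuration unchanged are counted as inflow too, just as
  \<open>rate\<close> counts them as outflow.\<close>

definition inflow :: "(nat list \<Rightarrow> real) \<Rightarrow> nat list \<Rightarrow> real" where
  "inflow q \<zeta> = (\<Sum>\<eta>\<in>configs s m. \<Sum>j<n. q \<eta> / x j * indicator {\<zeta>} (bell j \<eta>))"

lemma inflow_invariant:
  assumes "invariant_weight q" "\<zeta> \<in> configs s m"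
  shows "inflow q \<zeta> = rate * q \<zeta>"
proof -
  have "0 = (\<Sum>\<eta>\<in>configs s m. q \<eta> * generator n x (indicator {\<zeta>}) \<eta>)"
    using assms(1) by (simp add: invariant_weight_def)
  also have "\<dots> = (\<Sum>\<eta>\<in>configs s m. (\<Sum>j<n. q \<eta> / x j * indicator {\<zeta>} (bell j \<eta>)) - rate * q \<eta> * indicator {\<zeta>} \<eta>)"
    unfolding generator_def rate_def
    by (intro sum.cong refl)
      (simp add: sum_distrib_left sum_distrib_right sum_subtractf[symmetric] right_diff_distrib diff_divide_distrib mult_ac)
  also have "\<dots> = inflow q \<zeta> - rate * q \<zeta>"
    unfolding sum_subtractf inflow_def using sum_configs_indicator[OF assms(2), of "\<lambda>\<eta>. rate * q \<eta>"] by simp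
  finally show ?thesis by simp
qed

text \<open>Every bell leads to exactly one configuration with the same content, so nothing is
  lost.\<close>

lemma sum_inflow: "(\<Sum>\<zeta>\<in>configs s m. inflow q \<zeta>) = rate * (\<Sum>\<eta>\<in>configs s m. q \<eta>)"
proof -
  have "(\<Sum>\<zeta>\<in>configs s m. inflow q \<zeta>) =
    (\<Sum>\<eta>\<in>configs s m. \<Sum>j<n. \<Sum>\<zeta>\<in>configs s m. q \<eta> / x j * indicator {\<zeta>} (bell j \<eta>))"
    unfolding inflow_def by (subst sum.swap, intro sum.cong refl, rule sum.swap)
  also have "\<dots> = (\<Sum>\<eta>\<in>configs s m. \<Sum>j<n. q \<eta> / x j)"
  proof (intro sum.cong refl)
    fix \<eta> j assume "\<eta> \<in> configs s m" "j \<in> {..<n}"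
    then have "bell j \<eta> \<in> configs s m" using bell_configs by simp
    then show "(\<Sum>\<zeta>\<in>configs s m. q \<eta> / x j * indicator {\<zeta>} (bell j \<eta>)) = q \<eta> / x j"
      unfolding indicator_singleton_commute[of _ "bell j \<eta>"] by (rule sum_configs_indicator)
  qed
  also have "\<dots> = rate * (\<Sum>\<eta>\<in>configs s m. q \<eta>)"
    unfolding rate_def by (simp add: sum_product sum.swap[of _ "{..<n}"])
  finally show ?thesis .
qed

text \<open>
  The positive part of an invariant signed weight receives at least as much inflow as it loses, and
  in total exactly as much; so it is invariant too and its support is closed under every bell.
\<close>

lemma invariant_weight_pos_reset:
  assumes q: "invariant_weight q" and "\<eta> \<in> configs s m" "0 < q \<eta>"
  shows "0 < q reset_config"
proof -
  define u where "u \<eta> = max (q \<eta>) 0" for \<eta>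
  have mono: "inflow f \<zeta> \<le> inflow g \<zeta>" if "\<And>\<eta>. f \<eta> \<le> g \<eta>" for f g \<zeta>
    unfolding inflow_def
    by (intro sum_mono mult_right_mono divide_right_mono) (use that x_pos in \<open>auto simp: less_imp_le\<close>)
  have ge: "rate * u \<zeta> \<le> inflow u \<zeta>" if "\<zeta> \<in> configs s m" for \<zeta>
  proof -
    have "rate * q \<zeta> \<le> inflow u \<zeta>"
      using mono[of q u \<zeta>] inflow_invariant[OF q that] by (simp add: u_def)
    moreover have "0 \<le> inflow u \<zeta>"
      using mono[of "\<lambda>_. 0" u \<zeta>] by (simp add: u_def inflow_def)
    ultimately show ?thesis by (simp add: u_def max_def)
  qed
  \<comment> \<open>Both sides have the same finite total, so the termwise inequality is an
    equality.\<close>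
  have eq: "rate * u \<zeta> = inflow u \<zeta>" if "\<zeta> \<in> configs s m" for \<zeta>
    by (rule sum_mono_inv[OF _ ge that finite_configs]) (simp_all add: sum_inflow sum_distrib_left)
  have step: "0 < u (bell j \<zeta>)" if \<zeta>: "\<zeta> \<in> configs s m" "j < n" "0 < u \<zeta>" for \<zeta> j
  proof -
    let ?\<zeta>' = "bell j \<zeta>"
    have nonneg: "0 \<le> u \<eta> / x j * indicator {?\<zeta>'} \<xi>" if "j < n" for \<eta> \<xi> j
      using x_pos[OF that] by (simp add: u_def indicator_def)
    have "0 < u \<zeta> / x j * indicator {?\<zeta>'} (bell j \<zeta>)" using \<zeta>(3) x_pos[OF \<zeta>(2)] by simp
    also have "\<dots> \<le> (\<Sum>j<n. u \<zeta> / x j * indicator {?\<zeta>'} (bell j \<zeta>))"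
      by (rule member_le_sum[of j]) (use \<zeta>(2) nonneg in auto)
    also have "\<dots> \<le> inflow u ?\<zeta>'"
      unfolding inflow_def
      by (rule member_le_sum[OF \<zeta>(1) _ finite_configs, of "\<lambda>\<eta>. \<Sum>j<n. u \<eta> / x j * indicator {?\<zeta>'} (bell j \<eta>)"])
        (use nonneg in \<open>auto intro!: sum_nonneg\<close>)
    also have "\<dots> = rate * u ?\<zeta>'" using eq bell_configs[OF \<zeta>(1,2)] by simp
    finally show ?thesis using rate_nonneg by (simp add: zero_less_mult_iff)
  qed
  have "0 < u (fold bell [0..<k] \<eta>)" if "k \<le> n" for k
    using that
  proof (induction k)
    case 0
    then show ?case using assms(3) by (simp add: u_def)
  next
    case (Suc k)
    then show ?case using step[OF fold_bell_configs[OF assms(2)], of k k] by simp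
  qed
  from this[of n] show ?thesis using fold_bell_reset[OF assms(2)] by (simp add: u_def split: if_splits add: max_def)
qed

lemma invariant_weight_diff:
  assumes "invariant_weight p" "invariant_weight q"
  shows "invariant_weight (\<lambda>\<eta>. p \<eta> - q \<eta>)"
  using assms by (simp add: invariant_weight_def left_diff_distrib sum_subtractf)

text \<open>If \<open>p\<close> exceeds \<open>q\<close> anywhere, it does so at
  \<open>reset_config\<close>. Then \<open>q\<close> can exceed \<open>p\<close> nowhere, and the
  totals would differ.\<close>

lemma invariant_weight_unique:
  assumes p: "invariant_weight p" and q: "invariant_weight q"
    and sum: "(\<Sum>\<eta>\<in>configs s m. p \<eta>) = (\<Sum>\<eta>\<in>configs s m. q \<eta>)"
    and \<eta>: "\<eta> \<in> configs s m"
  shows "p \<eta> = q \<eta>"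
proof -
  have *: "p \<eta> \<le> q \<eta>" if p: "invariant_weight p" and q: "invariant_weight q"
    and sum: "(\<Sum>\<eta>\<in>configs s m. p \<eta>) = (\<Sum>\<eta>\<in>configs s m. q \<eta>)"
    and \<eta>: "\<eta> \<in> configs s m" for p q \<eta>
  proof (rule ccontr)
    assume "\<not> p \<eta> \<le> q \<eta>"
    then have pos: "0 < p \<eta> - q \<eta>" by simp
    then have reset: "q reset_config < p reset_config"
      using invariant_weight_pos_reset[OF invariant_weight_diff[OF p q] \<eta>] by simp
    have "q \<zeta> \<le> p \<zeta>" if \<zeta>: "\<zeta> \<in> configs s m" for \<zeta>
      using invariant_weight_pos_reset[OF invariant_weight_diff[OF q p] \<zeta>] reset by force
    then have "(\<Sum>\<eta>\<in>configs s m. q \<eta>) < (\<Sum>\<eta>\<in>configs s m. p \<eta>)"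
      using finite_configs \<eta> pos by (intro sum_strict_mono_ex1) auto
    then show False using sum by simp
  qed
  show ?thesis using *[OF p q sum \<eta>] *[OF q p sum[symmetric] \<eta>] by simp
qed

lemma stationary_distribution_iff:
  "stationary_distribution n s m x p \<longleftrightarrow> (\<forall>\<eta>\<in>configs s m. p \<eta> = multiline_prob \<eta>)"
proof
  assume "stationary_distribution n s m x p"
  then have "invariant_weight p" "(\<Sum>\<eta>\<in>configs s m. p \<eta>) = 1"
    unfolding stationary_distribution_def semigroup_stationary_iff by auto
  then show "\<forall>\<eta>\<in>configs s m. p \<eta> = multiline_prob \<eta>"
    using invariant_weight_unique[OF _ multiline_prob_invariant] multiline_prob_sum by simp
next
  assume p: "\<forall>\<eta>\<in>configs s m. p \<eta> = multiline_prob \<eta>"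
  have "invariant_weight p"
    using multiline_prob_invariant p by (simp add: invariant_weight_def)
  moreover have "(\<Sum>\<eta>\<in>configs s m. p \<eta>) = 1" using multiline_prob_sum p by simp
  ultimately show "stationary_distribution n s m x p"
    unfolding stationary_distribution_def semigroup_stationary_iff
    using p multiline_prob_nonneg by simp
qed

end

theorem theorem17:
  fixes n s :: nat and m :: "nat \<Rightarrow> nat" and x :: "nat \<Rightarrow> real" and p :: "nat list \<Rightarrow> real"
  assumes "n = (\<Sum>r\<le>s. m r)"
    and "m 0 \<ge> 1"
    and "\<And>i. i < n \<Longrightarrow> x i > 0"
  shows "(stationary_distribution n s m x p \<longleftrightarrow>
            (\<forall>\<eta>\<in>configs s m.
               p \<eta> = (\<Sum>\<xi> | \<xi> \<in> diagrams n s m \<and> bottom_labels n s \<xi> = \<eta>. diagram_prob n s m x \<xi>)))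
       \<and> (\<forall>\<eta>\<in>configs s m.
            (\<Sum>\<xi> | \<xi> \<in> diagrams n s m \<and> bottom_labels n s \<xi> = \<eta>. diagram_prob n s m x \<xi>)
            = 1 / partition_fun n s m x *
              (\<Sum>\<xi> | \<xi> \<in> diagrams n s m \<and> bottom_labels n s \<xi> = \<eta>. wt n s x \<xi>))"
proof -
  interpret push_tasep n s m x
    using assms by unfold_locales
  show ?thesis
    unfolding stationary_distribution_iff multiline_prob_def
    by (simp add: diagram_prob_def sum_divide_distrib)
qed

end
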